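(* Let $(B,0)$ be a branch in $(\mathbb{C}^2,0)$. Then $(B,0)$ can be described as the germ of the image of a single parametric equation, i.e. there is a parametric equation $\alpha$ for $(B,0)$ such that $(B,0)$ is equal to the germ at the origin of the image of $\alpha$.
   Context: A curve $(C,0)$ in $(\mathbb{C}^2,0)$ is the set-germ at the origin of $f^{-1}(0)$, where $f:(\mathbb{C}^2,0)\to(\mathbb{C},0)$ is a nonzero holomorphic function germ; it is a branch if $f$ can be chosen irreducible in the ring $\mathbb{C}\{x,y\}$ of holomorphic function germs. A parametric equation for a curve $(C,0)$ is a germ of an injective holomorphic mapping $\alpha:(\mathbb{C},0)\to(\mathbb{C}^2,0)$ whose image is contained in $(C,0)$; such an $\alpha$ is open onto its image, so the germ at the origin of its image is well defined. *)

theory Defs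
  imports "HOL-Complex_Analysis.Complex_Analysis"
    "HOL-Computational_Algebra.Factorial_Ring"
begin

(* Total differentiability over the complex numbers: the derivative at p is the
   complex-linear form (h, k) |-> a * h + b * k. *)
definition complex_differentiable2 ::
    "(complex \<times> complex \<Rightarrow> complex) \<Rightarrow> complex \<times> complex \<Rightarrow> bool" where
  "complex_differentiable2 f p \<longleftrightarrow>
     (\<exists>a b. (f has_derivative (\<lambda>v. a * fst v + b * snd v)) (at p))"

definition holomorphic_near0 :: "(complex \<times> complex \<Rightarrow> complex) \<Rightarrow> bool" where
  "holomorphic_near0 f \<longleftrightarrow> (\<exists>U. open U \<and> 0 \<in> U \<and> (\<forall>p\<in>U. complex_differentiable2 f p))"

lemma holomorphic_near0_iff:
  "holomorphic_near0 f \<longleftrightarrow> (\<forall>\<^sub>F p in nhds 0. complex_differentiable2 f p)"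
  unfolding holomorphic_near0_def eventually_nhds by blast

lemma complex_differentiable2_const: "complex_differentiable2 (\<lambda>_. c) p"
  unfolding complex_differentiable2_def
  by (rule exI[of _ 0], rule exI[of _ 0]) simp

lemma complex_differentiable2_add:
  assumes "complex_differentiable2 f p" "complex_differentiable2 g p"
  shows "complex_differentiable2 (\<lambda>q. f q + g q) p"
proof -
  obtain a b c d where
    f: "(f has_derivative (\<lambda>v. a * fst v + b * snd v)) (at p)" and
    g: "(g has_derivative (\<lambda>v. c * fst v + d * snd v)) (at p)"
    using assms unfolding complex_differentiable2_def by blast
  have "((\<lambda>q. f q + g q) has_derivative (\<lambda>v. (a + c) * fst v + (b + d) * snd v)) (at p)"
    using has_derivative_add[OF f g] by (rule has_derivative_eq_rhs) (simp add: algebra_simps fun_eq_iff)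
  then show ?thesis unfolding complex_differentiable2_def by blast
qed

lemma complex_differentiable2_mult:
  assumes "complex_differentiable2 f p" "complex_differentiable2 g p"
  shows "complex_differentiable2 (\<lambda>q. f q * g q) p"
proof -
  obtain a b c d where
    f: "(f has_derivative (\<lambda>v. a * fst v + b * snd v)) (at p)" and
    g: "(g has_derivative (\<lambda>v. c * fst v + d * snd v)) (at p)"
    using assms unfolding complex_differentiable2_def by blast
  have "((\<lambda>q. f q * g q) has_derivative
      (\<lambda>v. (f p * c + a * g p) * fst v + (f p * d + b * g p) * snd v)) (at p)"
    using has_derivative_mult[OF f g] by (rule has_derivative_eq_rhs) (simp add: algebra_simps fun_eq_iff)
  then show ?thesis unfolding complex_differentiable2_def by blast
qed

lemma complex_differentiable2_uminus:
  assumes "complex_differentiable2 f p"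
  shows "complex_differentiable2 (\<lambda>q. - f q) p"
  using complex_differentiable2_mult[OF complex_differentiable2_const[of "-1"] assms] by simp

lemma holomorphic_near0_const: "holomorphic_near0 (\<lambda>_. c)"
  by (simp add: holomorphic_near0_iff complex_differentiable2_const)

lemma holomorphic_near0_add:
  "holomorphic_near0 f \<Longrightarrow> holomorphic_near0 g \<Longrightarrow> holomorphic_near0 (\<lambda>q. f q + g q)"
  unfolding holomorphic_near0_iff
  by (erule (1) eventually_elim2) (rule complex_differentiable2_add)

lemma holomorphic_near0_mult:
  "holomorphic_near0 f \<Longrightarrow> holomorphic_near0 g \<Longrightarrow> holomorphic_near0 (\<lambda>q. f q * g q)"
  unfolding holomorphic_near0_iff
  by (erule (1) eventually_elim2) (rule complex_differentiable2_mult)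

lemma holomorphic_near0_uminus:
  "holomorphic_near0 f \<Longrightarrow> holomorphic_near0 (\<lambda>q. - f q)"
  unfolding holomorphic_near0_iff
  by (erule eventually_mono) (rule complex_differentiable2_uminus)


definition holo_germ_rel ::
    "(complex \<times> complex \<Rightarrow> complex) \<Rightarrow> (complex \<times> complex \<Rightarrow> complex) \<Rightarrow> bool" where
  "holo_germ_rel f g \<longleftrightarrow> holomorphic_near0 f \<and> holomorphic_near0 g \<and>
     (\<forall>\<^sub>F p in nhds 0. f p = g p)"

(* The ring of convergent power series in two variables, realised as the ring of germs
   at the origin of holomorphic functions. *)
quotient_type holo_germ = "complex \<times> complex \<Rightarrow> complex" / partial: holo_germ_rel
proof (rule part_equivpI)
  show "\<exists>f. holo_germ_rel f f"
    by (rule exI[of _ "\<lambda>_. 0"]) (simp add: holo_germ_rel_def holomorphic_near0_const)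
  show "symp holo_germ_rel"
    by (auto simp: symp_def holo_germ_rel_def eq_commute)
  show "transp holo_germ_rel"
    unfolding transp_def holo_germ_rel_def by (auto elim: eventually_elim2)
qed

instantiation holo_germ :: comm_ring_1
begin

lift_definition zero_holo_germ :: holo_germ is "\<lambda>_. 0"
  by (simp add: holo_germ_rel_def holomorphic_near0_const)

lift_definition one_holo_germ :: holo_germ is "\<lambda>_. 1"
  by (simp add: holo_germ_rel_def holomorphic_near0_const)

lift_definition plus_holo_germ :: "holo_germ \<Rightarrow> holo_germ \<Rightarrow> holo_germ"
  is "\<lambda>f g p. f p + g p"
  unfolding holo_germ_rel_def
  by (auto intro: holomorphic_near0_add elim: eventually_elim2)

lift_definition times_holo_germ :: "holo_germ \<Rightarrow> holo_germ \<Rightarrow> holo_germ"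
  is "\<lambda>f g p. f p * g p"
  unfolding holo_germ_rel_def
  by (auto intro: holomorphic_near0_mult elim: eventually_elim2)

lift_definition uminus_holo_germ :: "holo_germ \<Rightarrow> holo_germ"
  is "\<lambda>f p. - f p"
  unfolding holo_germ_rel_def
  by (auto intro: holomorphic_near0_uminus elim: eventually_mono)

definition minus_holo_germ :: "holo_germ \<Rightarrow> holo_germ \<Rightarrow> holo_germ" where
  "minus_holo_germ f g = f + - g"

instance
proof
  fix a b c :: holo_germ
  show "a * b * c = a * (b * c)"
    by transfer (simp add: holo_germ_rel_def holomorphic_near0_mult mult.assoc)
  show "a * b = b * a"
    by transfer (simp add: holo_germ_rel_def holomorphic_near0_mult mult.commute)
  show "1 * a = a"
    by transfer (simp add: holo_germ_rel_def)
  show "a + b + c = a + (b + c)"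
    by transfer (simp add: holo_germ_rel_def holomorphic_near0_add add.assoc)
  show "a + b = b + a"
    by transfer (simp add: holo_germ_rel_def holomorphic_near0_add add.commute)
  show "0 + a = a"
    by transfer (simp add: holo_germ_rel_def)
  show "- a + a = 0"
    by transfer (simp add: holo_germ_rel_def holomorphic_near0_const)
  show "a - b = a + - b"
    by (rule minus_holo_germ_def)
  show "(a + b) * c = a * c + b * c"
    by transfer (simp add: holo_germ_rel_def holomorphic_near0_add holomorphic_near0_mult
        distrib_right)
  show "(0::holo_germ) \<noteq> 1"
    by transfer (auto simp: holo_germ_rel_def dest: eventually_nhds_x_imp_x)
qed

end

lift_definition germ_value0 :: "holo_germ \<Rightarrow> complex" is "\<lambda>f. f 0"
  by (auto simp: holo_germ_rel_def dest: eventually_nhds_x_imp_x)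


definition set_germ_rel :: "'a::{topological_space, zero} set \<Rightarrow> 'a set \<Rightarrow> bool" where
  "set_germ_rel A B \<longleftrightarrow> (\<exists>U. open U \<and> 0 \<in> U \<and> A \<inter> U = B \<inter> U)"

lemma set_germ_rel_iff: "set_germ_rel A B \<longleftrightarrow> (\<forall>\<^sub>F p in nhds 0. p \<in> A \<longleftrightarrow> p \<in> B)"
  unfolding set_germ_rel_def eventually_nhds by blast

quotient_type (overloaded) 'a set_germ = "'a::{topological_space, zero} set" / set_germ_rel
proof (rule equivpI)
  show "reflp (set_germ_rel :: 'a set \<Rightarrow> 'a set \<Rightarrow> bool)"
    by (simp add: reflp_def set_germ_rel_iff)
  show "symp (set_germ_rel :: 'a set \<Rightarrow> 'a set \<Rightarrow> bool)"
    by (auto simp: symp_def set_germ_rel_iff eq_commute)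
  show "transp (set_germ_rel :: 'a set \<Rightarrow> 'a set \<Rightarrow> bool)"
    unfolding transp_def set_germ_rel_iff by (auto elim: eventually_elim2)
qed

lift_definition set_germ :: "'a::{topological_space, zero} set \<Rightarrow> 'a set_germ" is "\<lambda>A. A" .

lift_definition subgerm ::
    "'a::{topological_space, zero} set_germ \<Rightarrow> 'a set_germ \<Rightarrow> bool"
  is "\<lambda>A B. \<exists>U. open U \<and> 0 \<in> U \<and> A \<inter> U \<subseteq> B"
proof -
  have *: "(\<exists>U. open U \<and> 0 \<in> U \<and> A \<inter> U \<subseteq> B) \<longleftrightarrow> (\<forall>\<^sub>F p in nhds 0. p \<in> A \<longrightarrow> p \<in> B)"
    for A B :: "'a set"
    unfolding eventually_nhds by blast
  fix A A' B B' :: "'a set"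
  assume "set_germ_rel A A'" "set_germ_rel B B'"
  then have "\<forall>\<^sub>F p in nhds 0. (p \<in> A \<longrightarrow> p \<in> B) \<longleftrightarrow> (p \<in> A' \<longrightarrow> p \<in> B')"
    unfolding set_germ_rel_iff by (auto elim: eventually_elim2)
  then show "(\<exists>U. open U \<and> 0 \<in> U \<and> A \<inter> U \<subseteq> B) = (\<exists>U. open U \<and> 0 \<in> U \<and> A' \<inter> U \<subseteq> B')"
    unfolding * by (rule eventually_subst)
qed

lift_definition zero_set_germ :: "holo_germ \<Rightarrow> (complex \<times> complex) set_germ"
  is "\<lambda>f. f -` {0}"
  unfolding holo_germ_rel_def set_germ_rel_iff by (auto elim: eventually_mono)


definition is_curve :: "(complex \<times> complex) set_germ \<Rightarrow> bool" where
  "is_curve C \<longleftrightarrow> (\<exists>f. f \<noteq> 0 \<and> germ_value0 f = 0 \<and> C = zero_set_germ f)"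

definition is_branch :: "(complex \<times> complex) set_germ \<Rightarrow> bool" where
  "is_branch B \<longleftrightarrow>
     (\<exists>f. f \<noteq> 0 \<and> germ_value0 f = 0 \<and> irreducible f \<and> B = zero_set_germ f)"

(* The mapping germ is given by a representative; only its values near 0 matter. *)
definition parametric_equation ::
    "(complex \<Rightarrow> complex \<times> complex) \<Rightarrow> (complex \<times> complex) set_germ \<Rightarrow> bool" where
  "parametric_equation \<alpha> C \<longleftrightarrow> is_curve C \<and> \<alpha> 0 = 0 \<and>
     (\<exists>U. open U \<and> 0 \<in> U \<and> (\<lambda>z. fst (\<alpha> z)) holomorphic_on U \<and>
          (\<lambda>z. snd (\<alpha> z)) holomorphic_on U \<and> inj_on \<alpha> U \<and> subgerm (set_germ (\<alpha> ` U)) C)"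

(* The image of one fixed neighbourhood of 0 need not represent the image germ, even if \<alpha> is
   injective there: \<alpha> may return towards the origin as z leaves every compact subset.  The image
   germ is the common germ of the images of all sufficiently small neighbourhoods. *)
definition has_image_germ ::
    "(complex \<Rightarrow> complex \<times> complex) \<Rightarrow> (complex \<times> complex) set_germ \<Rightarrow> bool" where
  "has_image_germ \<alpha> G \<longleftrightarrow>
     (\<exists>U. open U \<and> 0 \<in> U \<and>
        (\<forall>V. open V \<and> 0 \<in> V \<and> V \<subseteq> U \<longrightarrow> set_germ (\<alpha> ` V) = G))"

end

theory Submission
  imports Defs "HOL-Computational_Algebra.Fundamental_Theorem_Algebra"
begin

text \<open>
  Let \<open>f\<close> be an irreducible germ with zero set \<open>B\<close>. If \<open>f\<close> vanishes on the line \<open>x = 0\<close>, then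
  \<open>x\<close> divides \<open>f\<close>, by irreducibility the cofactor is a unit, and \<open>B\<close> is the \<open>y\<close>-axis,
  parametrized by \<open>t \<mapsto> (0, t)\<close>.
  Otherwise \<open>f(0, y)\<close> has a zero of finite order at \<open>y = 0\<close>, and there are two steps.

  Existence of one Puiseux root: there are \<open>N > 0\<close> and a holomorphic \<open>\<phi>\<close> with \<open>\<phi>(0) = 0\<close> and
  \<open>f(t^N, \<phi>(t)) = 0\<close> (\<open>puiseux_root_exists\<close>). The proof is by induction on the order \<open>n\<close> of
  \<open>f(0, y)\<close>. A shift of \<open>y\<close> by a holomorphic function of \<open>x\<close> removes the coefficient of \<open>y^(n-1)\<close>.
  If \<open>f(x, 0)\<close> then vanishes identically, \<open>\<phi> = 0\<close> is a root. Otherwise the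
  substitution \<open>x = t^q, y = t^p z\<close>, where \<open>p/q\<close> is read off the Newton polygon, turns \<open>f\<close>
  into \<open>t^(pn) k(t, z)\<close>, where \<open>k(0, z)\<close> is a polynomial of degree \<open>n\<close> with no \<open>z^(n-1)\<close> term but
  with a nonzero term of lower degree. It is not of the form \<open>c(z - z0)^n\<close>, so all its roots have
  multiplicity less than \<open>n\<close>, and the induction hypothesis applies at any of them
  (\<open>newton_step\<close>). Everything stays inside convergent germs, so no formal power series solution
  has to be shown to converge.

  The root gives the whole branch: take \<open>N\<close> minimal and let \<open>\<zeta> = exp(2 \<pi> \<i> / N)\<close>. If \<open>\<phi>\<close>
  were invariant under a nontrivial power of \<open>\<zeta>\<close>, it would be a function of some \<open>t^d\<close> with
  \<open>d > 1\<close> and \<open>N\<close> could be lowered; hence the conjugates \<open>\<phi>(\<zeta>^k t)\<close> are pairwise distinct for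
  small \<open>t \<noteq> 0\<close> (\<open>puiseux_root_minimal_imp_conjugates_differ\<close>). So \<open>t \<mapsto> (t^N, \<phi>(t))\<close> is
  injective, and \<open>f(x^N, y)\<close> is divisible by the product of the \<open>y - \<phi>(\<zeta>^k x)\<close>. Both this product
  and its cofactor are invariant under \<open>x \<mapsto> \<zeta> x\<close>, hence are holomorphic functions of \<open>(x^N, y)\<close>,
  and \<open>f\<close> itself factors as \<open>F * G\<close> (\<open>puiseux_root_factor\<close>). Here \<open>F\<close> is not a unit, so
  irreducibility makes \<open>G\<close> a unit, and the zeros of \<open>f\<close> are those of \<open>F\<close>, which form the image of
  \<open>t \<mapsto> (t^N, \<phi>(t))\<close>.

  The two operations on germs behind all of this are division by \<open>y\<close>
  (\<open>holomorphic_near0_divide_snd\<close>) and descent along \<open>x \<mapsto> x^d\<close> (\<open>holomorphic_near0_descend\<close>).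
  Both produce functions that are continuous and holomorphic in each variable, and Osgood's
  lemma (\<open>osgood\<close>) makes them holomorphic.
\<close>

section \<open>Complex differentiability in two variables\<close>

lemma complex_differentiable2_cong:
  assumes "\<forall>\<^sub>F q in nhds p. f q = g q"
  shows "complex_differentiable2 f p \<longleftrightarrow> complex_differentiable2 g p"
proof -
  have "(f has_derivative D) (at p) \<longleftrightarrow> (g has_derivative D) (at p)" for D
    using assms eventually_nhds_x_imp_x[OF assms] has_derivative_transform_eventually[of f D p UNIV g]
      has_derivative_transform_eventually[of g D p UNIV f]
    by (auto simp: eventually_nhds_conv_at eq_commute)
  then show ?thesis
    by (simp add: complex_differentiable2_def)
qed

lemma complex_differentiable2_fst: "complex_differentiable2 fst p"
  unfolding complex_differentiable2_def
  by (rule exI[of _ 1], rule exI[of _ 0]) (auto intro!: derivative_eq_intros)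

lemma complex_differentiable2_snd: "complex_differentiable2 snd p"
  unfolding complex_differentiable2_def
  by (rule exI[of _ 0], rule exI[of _ 1]) (auto intro!: derivative_eq_intros)

lemma complex_differentiable2_compose:
  assumes "complex_differentiable2 f (u p, v p)"
    and "complex_differentiable2 u p" "complex_differentiable2 v p"
  shows "complex_differentiable2 (\<lambda>q. f (u q, v q)) p"
proof -
  obtain a b c d e h where
    f: "(f has_derivative (\<lambda>v. a * fst v + b * snd v)) (at (u p, v p))" and
    u: "(u has_derivative (\<lambda>v. c * fst v + d * snd v)) (at p)" and
    v: "(v has_derivative (\<lambda>v. e * fst v + h * snd v)) (at p)"
    using assms unfolding complex_differentiable2_def by blast
  have "((\<lambda>q. f (u q, v q)) has_derivative
      (\<lambda>v. (a * c + b * e) * fst v + (a * d + b * h) * snd v)) (at p)"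
    using has_derivative_compose[OF has_derivative_Pair[OF u v] f]
    by (rule has_derivative_eq_rhs) (simp add: algebra_simps fun_eq_iff)
  then show ?thesis unfolding complex_differentiable2_def by blast
qed

lemma complex_differentiable2_compose1:
  assumes "\<phi> field_differentiable at (u p)" and "complex_differentiable2 u p"
  shows "complex_differentiable2 (\<lambda>q. \<phi> (u q)) p"
proof -
  obtain a c d where
    f: "(\<phi> has_derivative (\<lambda>h. a * h)) (at (u p))" and
    u: "(u has_derivative (\<lambda>v. c * fst v + d * snd v)) (at p)"
    using assms unfolding complex_differentiable2_def field_differentiable_def
    by (auto simp: has_field_derivative_def)
  have "((\<lambda>q. \<phi> (u q)) has_derivative (\<lambda>v. (a * c) * fst v + (a * d) * snd v)) (at p)"
    using has_derivative_compose[OF u f]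
    by (rule has_derivative_eq_rhs) (simp add: algebra_simps fun_eq_iff)
  then show ?thesis unfolding complex_differentiable2_def by blast
qed

lemma complex_differentiable2_imp_isCont:
  "complex_differentiable2 f p \<Longrightarrow> isCont f p"
  unfolding complex_differentiable2_def by (auto intro: has_derivative_continuous)

lemma complex_differentiable2_curve:
  assumes f: "complex_differentiable2 f (u t, v t)"
    and u: "u field_differentiable at t" and v: "v field_differentiable at t"
  shows "(\<lambda>t. f (u t, v t)) field_differentiable at t"
proof -
  obtain a b c d where
    f: "(f has_derivative (\<lambda>v. a * fst v + b * snd v)) (at (u t, v t))" and
    u: "(u has_derivative (\<lambda>h. c * h)) (at t)" and
    v: "(v has_derivative (\<lambda>h. d * h)) (at t)"
    using assms unfolding complex_differentiable2_def field_differentiable_def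
    by (auto simp: has_field_derivative_def)
  have "((\<lambda>t. f (u t, v t)) has_derivative (\<lambda>h. (a * c + b * d) * h)) (at t)"
    using has_derivative_compose[OF has_derivative_Pair[OF u v] f]
    by (rule has_derivative_eq_rhs) (simp add: algebra_simps fun_eq_iff)
  then show ?thesis
    unfolding field_differentiable_def has_field_derivative_def by blast
qed

section \<open>Osgood's lemma\<close>

definition deriv_snd :: "(complex \<times> complex \<Rightarrow> complex) \<Rightarrow> complex \<times> complex \<Rightarrow> complex" where
  "deriv_snd f p = deriv (\<lambda>w. f (fst p, w)) (snd p)"

text \<open>By Cauchy's inequality, \<open>|\<partial>f/\<partial>y (x, y) - \<partial>f/\<partial>y (x0, y)|\<close> is bounded by the supremum of
  \<open>|f(x, w) - f(x0, w)|\<close> over a circle around \<open>y\<close>, which is small for \<open>x\<close> near \<open>x0\<close> by uniform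
  continuity, uniformly in \<open>y\<close> near \<open>y0\<close>.\<close>

lemma isCont_deriv_snd:
  assumes "open A" "open B" and cont: "continuous_on (A \<times> B) f"
    and hol: "\<And>x. x \<in> A \<Longrightarrow> (\<lambda>w. f (x, w)) holomorphic_on B"
    and x0: "x0 \<in> A" and y0: "y0 \<in> B"
  shows "isCont (deriv_snd f) (x0, y0)"
proof -
  obtain s where s: "s > 0" "cball x0 s \<subseteq> A"
    using \<open>open A\<close> x0 open_contains_cball by blast
  obtain r0 where r0: "r0 > 0" "cball y0 r0 \<subseteq> B"
    using \<open>open B\<close> y0 open_contains_cball by blast
  define r where "r = r0 / 2"
  have r: "r > 0" "cball y0 (r + r) \<subseteq> B" using r0 by (auto simp: r_def)
  have sub: "cball y r \<subseteq> cball y0 (r + r)" if "dist y0 y < r" for y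
  proof
    fix w assume "w \<in> cball y r"
    then show "w \<in> cball y0 (r + r)"
      using dist_triangle[of y0 w y] that by simp
  qed
  have uc: "uniformly_continuous_on (cball x0 s \<times> cball y0 (r + r)) f"
    by (rule compact_uniformly_continuous)
      (use s r cont in \<open>auto intro!: compact_Times continuous_on_subset[OF cont]\<close>)
  have "\<forall>\<^sub>F p in nhds (x0, y0). dist (deriv_snd f p) (deriv_snd f (x0, y0)) < e" if "e > 0" for e
  proof -
    define e' where "e' = e / 3"
    have e': "e' > 0" using that by (simp add: e'_def)
    obtain d where d: "d > 0" "\<And>p q. p \<in> cball x0 s \<times> cball y0 (r + r) \<Longrightarrow>
        q \<in> cball x0 s \<times> cball y0 (r + r) \<Longrightarrow> dist q p < d \<Longrightarrow> dist (f q) (f p) < e' * r"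
      using uc[unfolded uniformly_continuous_on_def, rule_format, of "e' * r"] e' r by auto
    have near: "cmod (deriv_snd f (x, y) - deriv_snd f (x0, y)) \<le> e'"
      if x: "dist x0 x < min s d" and y: "dist y0 y < r" for x y
    proof -
      let ?g = "\<lambda>w. f (x, w) - f (x0, w)"
      have xA: "x \<in> A" using x s by auto
      have yB: "cball y r \<subseteq> B" using sub[OF y] r by blast
      then have yB': "y \<in> B" using r by auto
      have holg: "?g holomorphic_on B"
        by (intro holomorphic_intros hol xA x0)
      have "cmod ((deriv ^^ 1) ?g y) \<le> fact 1 * (e' * r) / r ^ 1"
      proof (rule Cauchy_inequality)
        show "?g holomorphic_on ball y r"
          using holg yB by (meson ball_subset_cball holomorphic_on_subset)
        show "continuous_on (cball y r) ?g"
          using holg yB by (meson holomorphic_on_imp_continuous_on holomorphic_on_subset)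
        fix w assume w: "cmod (y - w) = r"
        have "w \<in> cball y0 (r + r)" using sub[OF y] w by (auto simp: dist_norm)
        then show "cmod (?g w) \<le> e' * r"
          using d(2)[of "(x0, w)" "(x, w)"] x s
          by (auto simp: dist_Pair_Pair dist_norm[symmetric] dist_commute less_imp_le)
      qed (use r in auto)
      moreover have "deriv ?g y = deriv_snd f (x, y) - deriv_snd f (x0, y)"
        unfolding deriv_snd_def fst_conv snd_conv
        by (rule deriv_diff; rule holomorphic_on_imp_differentiable_at[OF hol \<open>open B\<close> yB'])
          (use xA x0 in auto)
      ultimately show ?thesis using r by simp
    qed
    have "isCont (deriv (\<lambda>w. f (x0, w))) y0"
      using holomorphic_deriv[OF hol[OF x0] \<open>open B\<close>] \<open>open B\<close> y0
      by (metis continuous_on_eq_continuous_at holomorphic_on_imp_continuous_on)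
    then have "\<forall>\<^sub>F y in nhds y0. dist (deriv_snd f (x0, y)) (deriv_snd f (x0, y0)) < e'"
      unfolding deriv_snd_def fst_conv snd_conv isCont_def tendsto_at_iff_tendsto_nhds
      by (rule tendstoD) (rule e')
    then obtain t where t: "t > 0"
      "\<And>y. dist y y0 < t \<Longrightarrow> dist (deriv_snd f (x0, y)) (deriv_snd f (x0, y0)) < e'"
      unfolding eventually_nhds_metric by blast
    have "dist (deriv_snd f (x, y)) (deriv_snd f (x0, y0)) < e"
      if x: "dist x x0 < min s d" and y: "dist y y0 < min r t" for x y
      using near[of x y] t(2)[of y] x y e'
        dist_triangle[of "deriv_snd f (x, y)" "deriv_snd f (x0, y0)" "deriv_snd f (x0, y)"]
      by (simp add: dist_norm norm_minus_commute e'_def)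
    then show ?thesis
      using s(1) d(1) r(1) t(1)
      by (intro eventually_nhds_metric[THEN iffD2] exI[of _ "min (min s d) (min r t)"])
        (auto simp: dist_Pair_Pair intro: le_less_trans[OF real_sqrt_sum_squares_ge1]
          le_less_trans[OF real_sqrt_sum_squares_ge2])
  qed
  then show ?thesis
    unfolding isCont_def tendsto_at_iff_tendsto_nhds by (intro tendstoI)
qed

text \<open>A function with a partial derivative in \<open>x\<close> and a jointly continuous partial derivative in \<open>y\<close>
  is differentiable, and holomorphy in \<open>y\<close> supplies that continuity.\<close>

lemma osgood:
  assumes "open A" "open B" "convex B" and cont: "continuous_on (A \<times> B) f"
    and hol1: "\<And>y. y \<in> B \<Longrightarrow> (\<lambda>w. f (w, y)) holomorphic_on A"
    and hol2: "\<And>x. x \<in> A \<Longrightarrow> (\<lambda>w. f (x, w)) holomorphic_on B"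
    and p: "p \<in> A \<times> B"
  shows "complex_differentiable2 f p"
proof -
  obtain x0 y0 where p: "p = (x0, y0)" "x0 \<in> A" "y0 \<in> B" using p by auto
  let ?g = "\<lambda>x y. f (x, y)"
  obtain a where a: "((\<lambda>x. ?g x y0) has_derivative (\<lambda>h. a * h)) (at x0 within A)"
    using holomorphic_on_imp_differentiable_at[OF hol1[OF p(3)] \<open>open A\<close> p(2)]
    unfolding field_differentiable_def has_field_derivative_def
    using has_derivative_at_withinI by blast
  define F where "F x y = blinfun_mult_left (deriv_snd f (x, y))" for x y
  have "((\<lambda>(x, y). ?g x y) has_derivative (\<lambda>(tx, ty). a * tx + F x0 y0 ty)) (at (x0, y0) within A \<times> B)"
  proof (rule has_derivative_partialsI[where f = ?g and fy = F, OF a _ _ p(3) \<open>convex B\<close>])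
    fix x y assume "x \<in> A" "y \<in> B"
    have "((\<lambda>w. f (x, w)) has_field_derivative deriv_snd f (x, y)) (at y)"
      unfolding deriv_snd_def fst_conv snd_conv
      by (rule holomorphic_derivI[OF hol2 \<open>open B\<close>]) fact+
    then show "(?g x has_derivative blinfun_apply (F x y)) (at y within B)"
      unfolding has_field_derivative_def F_def
      by (auto intro: has_derivative_at_withinI simp: mult.commute[of _ "deriv_snd f (x, y)"]
         elim!: has_derivative_eq_rhs)
  next
    have "isCont (\<lambda>p. blinfun_mult_left (deriv_snd f p)) (x0, y0)"
      by (intro bounded_linear.isCont[OF bounded_linear_blinfun_mult_left]
          isCont_deriv_snd[OF assms(1,2) cont hol2 p(2,3)])
    moreover have "(\<lambda>(x, y). F x y) = (\<lambda>p. blinfun_mult_left (deriv_snd f p))"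
      by (auto simp: F_def)
    ultimately show "continuous (at (x0, y0) within A \<times> B) (\<lambda>(x, y). F x y)"
      by (simp add: continuous_at_imp_continuous_at_within)
  qed
  then have "(f has_derivative (\<lambda>v. a * fst v + deriv_snd f (x0, y0) * snd v)) (at (x0, y0))"
    using at_within_open[of "(x0, y0)" "A \<times> B"] open_Times[OF \<open>open A\<close> \<open>open B\<close>] p
    by (simp add: F_def split_beta' mult.commute)
  then show ?thesis
    unfolding complex_differentiable2_def p(1) by blast
qed

section \<open>Partial derivatives and division by a coordinate\<close>

lemma eventually_nhds_0_polydisc:
  "(\<forall>\<^sub>F p in nhds 0. Q p) \<longleftrightarrow>
     (\<exists>r>0. \<forall>x\<in>ball 0 r. \<forall>y\<in>ball 0 r. Q (x :: complex, y :: complex))"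
proof
  assume "\<forall>\<^sub>F p in nhds 0. Q p"
  then obtain e where e: "e > 0" "\<And>p. dist p 0 < e \<Longrightarrow> Q p"
    unfolding eventually_nhds_metric by blast
  have "Q (x, y)" if "x \<in> ball 0 (e / 2)" "y \<in> ball 0 (e / 2)" for x y
  proof (rule e(2))
    have "norm (x, y) \<le> norm x + norm y" by (rule norm_Pair_le)
    also have "\<dots> < e" using that by simp
    finally show "dist (x, y) 0 < e" by simp
  qed
  then show "\<exists>r>0. \<forall>x\<in>ball 0 r. \<forall>y\<in>ball 0 r. Q (x, y)"
    using e(1) by (intro exI[of _ "e / 2"]) auto
next
  assume "\<exists>r>0. \<forall>x\<in>ball 0 r. \<forall>y\<in>ball 0 r. Q (x, y)"
  then obtain r where "r > 0" "\<forall>x\<in>ball 0 r. \<forall>y\<in>ball 0 r. Q (x, y)" by blast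
  then show "\<forall>\<^sub>F p in nhds 0. Q p"
    unfolding eventually_nhds
    by (intro exI[of _ "ball 0 r \<times> ball 0 r"]) (auto simp: open_Times zero_prod_def)
qed

lemma holomorphic_near0_polydisc:
  "holomorphic_near0 f \<longleftrightarrow>
     (\<exists>r>0. \<forall>x\<in>ball 0 r. \<forall>y\<in>ball 0 r. complex_differentiable2 f (x, y))"
  unfolding holomorphic_near0_iff by (rule eventually_nhds_0_polydisc)

lemma complex_differentiable2_slices:
  assumes "\<forall>p\<in>A \<times> B. complex_differentiable2 f p"
  shows "y \<in> B \<Longrightarrow> (\<lambda>w. f (w, y)) holomorphic_on A"
    and "x \<in> A \<Longrightarrow> (\<lambda>w. f (x, w)) holomorphic_on B"
    and "continuous_on (A \<times> B) f"
proof -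
  show "(\<lambda>w. f (w, y)) holomorphic_on A" if "y \<in> B"
    unfolding holomorphic_on_def
    using that complex_differentiable2_curve[of f "\<lambda>w. w" _ "\<lambda>w. y"] assms
    by (simp add: field_differentiable_at_within)
  show "(\<lambda>w. f (x, w)) holomorphic_on B" if "x \<in> A"
    unfolding holomorphic_on_def
    using that complex_differentiable2_curve[of f "\<lambda>w. x" _ "\<lambda>w. w"] assms
    by (simp add: field_differentiable_at_within)
  show "continuous_on (A \<times> B) f"
    using assms by (meson continuous_at_imp_continuous_on complex_differentiable2_imp_isCont)
qed

lemma continuous_on_deriv_snd:
  assumes "open A" "open B" "\<forall>p\<in>A \<times> B. complex_differentiable2 f p"
  shows "continuous_on (A \<times> B) (deriv_snd f)"
proof (intro continuous_at_imp_continuous_on ballI)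
  fix p :: "complex \<times> complex" assume "p \<in> A \<times> B"
  then show "isCont (deriv_snd f) p"
    using isCont_deriv_snd[OF assms(1,2) complex_differentiable2_slices(3,2)[OF assms(3)], of "fst p" "snd p"]
    by auto
qed

text \<open>The mean value inequality for \<open>w \<mapsto> f(x, w) - w c\<close>. It controls difference quotients in \<open>y\<close>
  in the three places where they occur: holomorphy of the partial derivative, division by \<open>y\<close>, and the
  contraction behind the implicit function theorem.\<close>

lemma deriv_snd_increment_bound:
  assumes "open B" "(\<lambda>w. f (x, w)) holomorphic_on B" "convex S" "S \<subseteq> B"
    and "\<And>w. w \<in> S \<Longrightarrow> cmod (deriv_snd f (x, w) - c) \<le> e" "u \<in> S" "v \<in> S"
  shows "cmod (f (x, u) - f (x, v) - (u - v) * c) \<le> e * cmod (u - v)"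
proof -
  let ?g = "\<lambda>w. f (x, w) - w * c"
  have "cmod (?g u - ?g v) \<le> e * cmod (u - v)"
  proof (rule field_differentiable_bound[OF \<open>convex S\<close>])
    fix w assume w: "w \<in> S"
    have "((\<lambda>w. f (x, w)) has_field_derivative deriv_snd f (x, w)) (at w within S)"
      unfolding deriv_snd_def fst_conv snd_conv
      by (rule holomorphic_derivI[OF assms(2,1)]) (use w assms(4) in auto)
    then show "(?g has_field_derivative deriv_snd f (x, w) - c) (at w within S)"
      by (auto intro!: derivative_eq_intros)
  qed (use assms in auto)
  then show ?thesis by (simp add: algebra_simps)
qed

text \<open>The difference quotients in \<open>y\<close> are holomorphic in \<open>x\<close> and converge locally uniformly, since
  the partial derivative is jointly continuous.\<close>

lemma holomorphic_on_deriv_snd: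
  assumes "open A" "open B" and f: "\<forall>p\<in>A \<times> B. complex_differentiable2 f p"
    and y: "y \<in> B"
  shows "(\<lambda>x. deriv_snd f (x, y)) holomorphic_on A"
proof -
  obtain \<epsilon> where \<epsilon>: "\<epsilon> > 0" "cball y \<epsilon> \<subseteq> B"
    using \<open>open B\<close> y open_contains_cball by blast
  define h :: "nat \<Rightarrow> complex" where "h n = of_real (\<epsilon> / Suc n)" for n
  have h0: "h n \<noteq> 0" for n using \<epsilon> by (simp add: h_def del: of_nat_Suc)
  have hle: "cmod (h n) \<le> \<epsilon>" for n
    using \<epsilon> by (simp add: h_def norm_divide field_simps del: of_real_add of_real_divide of_nat_Suc)
  have hlim: "(\<lambda>n. cmod (h n)) \<longlonglongrightarrow> 0"
  proof -
    have "(\<lambda>n. \<epsilon> / Suc n) \<longlonglongrightarrow> 0"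
      using LIMSEQ_Suc[OF lim_const_over_n[of \<epsilon>]] by simp
    moreover have "cmod (h n) = \<epsilon> / Suc n" for n
      unfolding h_def norm_of_real using \<epsilon>(1) by simp
    ultimately show ?thesis by simp
  qed
  note sl = complex_differentiable2_slices[OF f]
  show ?thesis
  proof (rule holomorphic_uniform_sequence[OF \<open>open A\<close>])
    fix n
    have "y + h n \<in> B" using \<epsilon>(2) hle[of n] by (auto simp: dist_norm)
    then show "(\<lambda>x. (f (x, y + h n) - f (x, y)) / h n) holomorphic_on A"
      by (intro holomorphic_intros sl h0 y) 
  next
    fix x assume "x \<in> A"
    then obtain d where d: "d > 0" "cball x d \<subseteq> A"
      using \<open>open A\<close> open_contains_cball by blast
    have cont: "continuous_on (A \<times> B) (deriv_snd f)"
      by (rule continuous_on_deriv_snd[OF assms(1,2) f])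
    have uc: "uniformly_continuous_on (cball x d \<times> cball y \<epsilon>) (deriv_snd f)"
      by (rule compact_uniformly_continuous)
        (use d \<epsilon> in \<open>auto intro!: compact_Times continuous_on_subset[OF cont]\<close>)
    have "uniform_limit (cball x d) (\<lambda>n x. (f (x, y + h n) - f (x, y)) / h n)
        (\<lambda>x. deriv_snd f (x, y)) sequentially"
    proof (rule uniform_limitI)
      fix e :: real assume e: "e > 0"
      obtain \<delta> where \<delta>: "\<delta> > 0" "\<And>p q. p \<in> cball x d \<times> cball y \<epsilon> \<Longrightarrow>
          q \<in> cball x d \<times> cball y \<epsilon> \<Longrightarrow> dist q p < \<delta> \<Longrightarrow>
          dist (deriv_snd f q) (deriv_snd f p) < e / 2"
        using uc[unfolded uniformly_continuous_on_def, rule_format, of "e / 2"] e by auto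
      have "\<forall>\<^sub>F n in sequentially. cmod (h n) < \<delta>"
        using order_tendstoD(2)[OF hlim \<open>\<delta> > 0\<close>] .
      then show "\<forall>\<^sub>F n in sequentially. \<forall>z\<in>cball x d.
          dist ((f (z, y + h n) - f (z, y)) / h n) (deriv_snd f (z, y)) < e"
      proof (eventually_elim, intro ballI)
        fix n z assume n: "cmod (h n) < \<delta>" and z: "z \<in> cball x d"
        have "cmod (f (z, y + h n) - f (z, y) - (y + h n - y) * deriv_snd f (z, y))
            \<le> e / 2 * cmod (y + h n - y)"
        proof (rule deriv_snd_increment_bound[where S = "cball y (cmod (h n))" and B = B])
          show "cball y (cmod (h n)) \<subseteq> B" using \<epsilon>(2) hle[of n] by (auto simp: subset_iff)
          show "(\<lambda>w. f (z, w)) holomorphic_on B" using sl(2) d z by auto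
          fix w assume "w \<in> cball y (cmod (h n))"
          then show "cmod (deriv_snd f (z, w) - deriv_snd f (z, y)) \<le> e / 2"
            using \<delta>(2)[of "(z, y)" "(z, w)"] z n hle[of n] \<epsilon>(1)
            by (auto simp: dist_Pair_Pair dist_norm[symmetric] dist_commute less_imp_le)
        qed (auto simp: dist_norm \<open>open B\<close>)
        then have *: "cmod (f (z, y + h n) - f (z, y) - h n * deriv_snd f (z, y)) \<le> e / 2 * cmod (h n)"
          by simp
        have "dist ((f (z, y + h n) - f (z, y)) / h n) (deriv_snd f (z, y))
            = cmod (f (z, y + h n) - f (z, y) - h n * deriv_snd f (z, y)) / cmod (h n)"
          using h0[of n] by (simp add: dist_norm diff_divide_distrib flip: norm_divide)
        also have "\<dots> \<le> e / 2"
          using * h0[of n] by (simp add: divide_le_eq)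
        finally show "dist ((f (z, y + h n) - f (z, y)) / h n) (deriv_snd f (z, y)) < e"
          using e by simp
      qed
    qed
    then show "\<exists>d>0. cball x d \<subseteq> A \<and> uniform_limit (cball x d)
        (\<lambda>n x. (f (x, y + h n) - f (x, y)) / h n) (\<lambda>x. deriv_snd f (x, y)) sequentially"
      using d by blast
  qed
qed

lemma holomorphic_near0_deriv_snd:
  assumes "holomorphic_near0 f"
  shows "holomorphic_near0 (deriv_snd f)"
proof -
  obtain r where r: "r > 0" "\<forall>p\<in>ball 0 r \<times> ball 0 r. complex_differentiable2 f p"
    using assms unfolding holomorphic_near0_polydisc by auto
  note sl = complex_differentiable2_slices[OF r(2)]
  have "complex_differentiable2 (deriv_snd f) p" if "p \<in> ball 0 r \<times> ball 0 r" for p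
  proof (rule osgood[OF open_ball open_ball convex_ball _ _ _ that])
    show "continuous_on (ball 0 r \<times> ball 0 r) (deriv_snd f)"
      by (rule continuous_on_deriv_snd[OF open_ball open_ball r(2)])
    show "(\<lambda>w. deriv_snd f (w, y)) holomorphic_on ball 0 r" if "y \<in> ball 0 r" for y
      by (rule holomorphic_on_deriv_snd[OF open_ball open_ball r(2) that])
    show "(\<lambda>w. deriv_snd f (x, w)) holomorphic_on ball 0 r" if "x \<in> ball 0 r" for x
      unfolding deriv_snd_def fst_conv snd_conv
      by (rule holomorphic_deriv[OF sl(2)[OF that] open_ball])
  qed
  then show ?thesis unfolding holomorphic_near0_polydisc using r(1) by auto
qed

text \<open>The quotient \<open>f(x, y) / y\<close>, extended by \<open>\<partial>f/\<partial>y (x, 0)\<close> on the line \<open>y = 0\<close>, is holomorphic in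
  each variable; it is continuous on that line because \<open>f(x, y) = f(x, y) - f(x, 0)\<close> is a small
  increment of \<open>f\<close>.\<close>

lemma holomorphic_near0_divide_snd:
  assumes "holomorphic_near0 f" and "\<forall>\<^sub>F x in nhds 0. f (x, 0) = 0"
  shows "\<exists>g. holomorphic_near0 g \<and> (\<forall>\<^sub>F p in nhds 0. f p = snd p * g p)"
proof -
  obtain r1 where r1: "r1 > 0" "\<forall>p\<in>ball 0 r1 \<times> ball 0 r1. complex_differentiable2 f p"
    using assms(1) unfolding holomorphic_near0_polydisc by auto
  obtain r2 where r2: "r2 > 0" "\<And>x. dist x 0 < r2 \<Longrightarrow> f (x, 0) = 0"
    using assms(2) unfolding eventually_nhds_metric by blast
  define r where "r = min r1 r2"
  have r: "r > 0" "\<forall>p\<in>ball 0 r \<times> ball 0 r. complex_differentiable2 f p"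
    "\<And>x. x \<in> ball 0 r \<Longrightarrow> f (x, 0) = 0"
    using r1 r2 by (auto simp: r_def)
  note sl = complex_differentiable2_slices[OF r(2)]
  define g where "g p = (if snd p = 0 then deriv_snd f p else f p / snd p)" for p
  have "complex_differentiable2 g p" if "p \<in> ball 0 r \<times> ball 0 r" for p
  proof (rule osgood[OF open_ball open_ball convex_ball _ _ _ that])
    have "isCont g (x0, y0)" if x0: "x0 \<in> ball 0 r" and y0: "y0 \<in> ball 0 r" for x0 y0
    proof (cases "y0 = 0")
      case False
      have "isCont (\<lambda>p. f p / snd p) (x0, y0)"
        using complex_differentiable2_imp_isCont[OF bspec[OF r(2), of "(x0, y0)"]] x0 y0 False
        by (intro continuous_divide continuous_snd continuous_ident) auto
      moreover have "\<forall>\<^sub>F p in nhds (x0, y0). g p = f p / snd p"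
      proof -
        have "open {p :: complex \<times> complex. snd p \<noteq> 0}"
          by (intro open_Collect_neq continuous_intros)
        then have "\<forall>\<^sub>F p :: complex \<times> complex in nhds (x0, y0). snd p \<noteq> 0"
          using False unfolding eventually_nhds
          by (intro exI[of _ "{p :: complex \<times> complex. snd p \<noteq> 0}"]) simp
        then show ?thesis by eventually_elim (simp add: g_def)
      qed
      ultimately show ?thesis by (simp add: isCont_cong)
    next
      case True
      have D: "isCont (deriv_snd f) (x0, 0)"
        using continuous_on_deriv_snd[OF open_ball open_ball r(2)] x0 r(1)
        by (simp add: continuous_on_eq_continuous_at open_Times)
      have "\<forall>\<^sub>F p in nhds (x0, 0). dist (g p) (g (x0, 0)) < e" if e: "e > 0" for e
      proof -
        define c where "c = deriv_snd f (x0, 0)"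
        have "\<forall>\<^sub>F p in nhds (x0, 0). dist (deriv_snd f p) c < e / 2"
          using D[unfolded isCont_def tendsto_at_iff_tendsto_nhds] e unfolding c_def
          by (intro tendstoD) auto
        then obtain S where S: "open S" "(x0, 0) \<in> S" "\<And>p :: complex \<times> complex. p \<in> S \<Longrightarrow> dist (deriv_snd f p) c < e / 2"
          unfolding eventually_nhds by blast
        obtain U and V :: "complex set" where UV: "open U" "open V" "x0 \<in> U" "0 \<in> V" "U \<times> V \<subseteq> S"
          using open_prod_elim[OF S(1,2)] by (metis mem_Times_iff fst_conv snd_conv)
        obtain s where s: "s > 0" "ball 0 s \<subseteq> V" using UV open_contains_ball by blast
        have "dist (g (x, y)) c < e" if x: "x \<in> U \<inter> ball 0 r" and y: "y \<in> ball 0 (min s r)" for x y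
        proof (cases "y = 0")
          case True
          have "(x, y) \<in> S" using True UV x by auto
          then show ?thesis using True S(3)[of "(x, y)"] e by (simp add: g_def)
        next
          case False
          have "cmod (f (x, y) - f (x, 0) - (y - 0) * c) \<le> e / 2 * cmod (y - 0)"
          proof (rule deriv_snd_increment_bound[where S = "ball 0 (min s r)" and B = "ball 0 r"])
            show "(\<lambda>w. f (x, w)) holomorphic_on ball 0 r" using sl(2) x by auto
            fix w :: complex assume "w \<in> ball 0 (min s r)"
            then have "(x, w) \<in> S" using UV s x by auto
            then show "cmod (deriv_snd f (x, w) - c) \<le> e / 2"
              using S(3)[of "(x, w)"] by (simp add: dist_norm less_imp_le)
          qed (use y s r(1) in auto)
          then have *: "cmod (f (x, y) - y * c) \<le> e / 2 * cmod y"
            using r(3)[of x] x by simp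
          have "dist (g (x, y)) c = cmod (f (x, y) - y * c) / cmod y"
            using False by (simp add: g_def dist_norm diff_divide_distrib flip: norm_divide)
          also have "\<dots> \<le> e / 2" using * False by (simp add: divide_le_eq)
          finally show ?thesis using e by simp
        qed
        moreover have "open ((U \<inter> ball 0 r) \<times> ball 0 (min s r))"
          using UV by (intro open_Times open_Int) auto
        moreover have "(x0, 0) \<in> (U \<inter> ball 0 r) \<times> ball 0 (min s r)"
          using x0 UV s r(1) by auto
        ultimately show ?thesis
          unfolding eventually_nhds
          by (intro exI[of _ "(U \<inter> ball 0 r) \<times> ball 0 (min s r)"]) (auto simp: g_def c_def)
      qed
      then show ?thesis
        unfolding True isCont_def tendsto_at_iff_tendsto_nhds by (intro tendstoI)
    qed
    then show "continuous_on (ball 0 r \<times> ball 0 r) g"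
      by (auto intro!: continuous_at_imp_continuous_on)
    show "(\<lambda>w. g (w, y)) holomorphic_on ball 0 r" if "y \<in> ball 0 r" for y
    proof (cases "y = 0")
      case True
      then show ?thesis
        using holomorphic_on_deriv_snd[OF open_ball open_ball r(2) that] by (simp add: g_def)
    next
      case False
      then show ?thesis
        using sl(1)[OF that] by (simp add: g_def holomorphic_on_divide)
    qed
    show "(\<lambda>w. g (x, w)) holomorphic_on ball 0 r" if "x \<in> ball 0 r" for x
    proof -
      have "(\<lambda>w. if w = 0 then deriv (\<lambda>w. f (x, w)) 0 else (f (x, w) - f (x, 0)) / (w - 0))
          holomorphic_on ball 0 r"
        by (rule pole_lemma[OF sl(2)[OF that]]) (use r(1) in auto)
      also have "(\<lambda>w. if w = 0 then deriv (\<lambda>w. f (x, w)) 0 else (f (x, w) - f (x, 0)) / (w - 0))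
          = (\<lambda>w. g (x, w))"
        using r(3)[OF that] by (auto simp: g_def deriv_snd_def fun_eq_iff)
      finally show ?thesis .
    qed
  qed
  moreover have "f (x, y) = y * g (x, y)" if "x \<in> ball 0 r" "y \<in> ball 0 r" for x y
    using that r(3)[of x] by (auto simp: g_def)
  ultimately show ?thesis
    using r(1) unfolding holomorphic_near0_polydisc eventually_nhds_0_polydisc
    by (intro exI[of _ g] conjI exI[of _ r]) auto
qed

section \<open>Composition of germs\<close>

lemma analytic_at_iff_eventually:
  "\<phi> analytic_on {z} \<longleftrightarrow> (\<forall>\<^sub>F w in nhds z. \<phi> field_differentiable (at w))"
proof
  assume "\<phi> analytic_on {z}"
  then obtain S where "open S" "z \<in> S" "\<phi> holomorphic_on S" unfolding analytic_at by blast
  then show "\<forall>\<^sub>F w in nhds z. \<phi> field_differentiable (at w)"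
    unfolding eventually_nhds using holomorphic_on_imp_differentiable_at by blast
next
  assume "\<forall>\<^sub>F w in nhds z. \<phi> field_differentiable (at w)"
  then obtain S where "open S" "z \<in> S" "\<forall>w\<in>S. \<phi> field_differentiable (at w)"
    unfolding eventually_nhds by blast
  then show "\<phi> analytic_on {z}"
    unfolding analytic_at by (auto simp: holomorphic_on_def intro: field_differentiable_at_within)
qed

lemma analytic_at_imp_filterlim: "\<phi> analytic_on {z} \<Longrightarrow> filterlim \<phi> (nhds (\<phi> z)) (nhds z)"
  using analytic_at_imp_isCont by (simp add: isCont_def tendsto_at_iff_tendsto_nhds)

lemma holomorphic_near0_imp_filterlim:
  "holomorphic_near0 f \<Longrightarrow> filterlim f (nhds (f 0)) (nhds 0)"
  unfolding holomorphic_near0_iff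
  using complex_differentiable2_imp_isCont eventually_nhds_x_imp_x
  by (metis isCont_def tendsto_at_iff_tendsto_nhds)

lemma filterlim_Pair_nhds_0:
  assumes "filterlim u (nhds 0) F" "filterlim v (nhds 0) F"
  shows "filterlim (\<lambda>q. (u q, v q)) (nhds (0 :: complex \<times> complex)) F"
  using tendsto_Pair[OF assms] by (simp add: zero_prod_def)

lemma holomorphic_near0_compose:
  assumes f: "holomorphic_near0 f" and u: "holomorphic_near0 u" and v: "holomorphic_near0 v"
    and "u 0 = 0" "v 0 = 0"
  shows "holomorphic_near0 (\<lambda>q. f (u q, v q))"
proof -
  have "filterlim (\<lambda>q. (u q, v q)) (nhds 0) (nhds 0)"
    using holomorphic_near0_imp_filterlim[OF u] holomorphic_near0_imp_filterlim[OF v] assms(4,5)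
    by (intro filterlim_Pair_nhds_0) auto
  then have "\<forall>\<^sub>F q in nhds 0. complex_differentiable2 f (u q, v q)"
    using f eventually_compose_filterlim unfolding holomorphic_near0_iff by fast
  then show ?thesis
    using u v unfolding holomorphic_near0_iff
    by eventually_elim (rule complex_differentiable2_compose)
qed

lemma holomorphic_near0_compose1:
  assumes \<phi>: "\<phi> analytic_on {u 0}" and u: "holomorphic_near0 u"
  shows "holomorphic_near0 (\<lambda>q. \<phi> (u q))"
proof -
  have "\<forall>\<^sub>F q in nhds 0. \<phi> field_differentiable (at (u q))"
    using \<phi> holomorphic_near0_imp_filterlim[OF u] eventually_compose_filterlim
    unfolding analytic_at_iff_eventually by fast
  then show ?thesis
    using u unfolding holomorphic_near0_iff
    by eventually_elim (rule complex_differentiable2_compose1)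
qed

lemma filterlim_curve:
  assumes "u analytic_on {0}" "v analytic_on {0}" "u 0 = 0" "v 0 = 0"
  shows "filterlim (\<lambda>t. (u t, v t)) (nhds (0 :: complex \<times> complex)) (nhds 0)"
  using analytic_at_imp_filterlim[OF assms(1)] analytic_at_imp_filterlim[OF assms(2)] assms(3,4)
  by (intro filterlim_Pair_nhds_0) auto

lemma holomorphic_near0_curve:
  assumes f: "holomorphic_near0 f" and uv: "u analytic_on {0}" "v analytic_on {0}" "u 0 = 0" "v 0 = 0"
  shows "(\<lambda>t. f (u t, v t)) analytic_on {0}"
proof -
  have "\<forall>\<^sub>F t in nhds 0. complex_differentiable2 f (u t, v t)"
    using f filterlim_curve[OF uv] eventually_compose_filterlim
    unfolding holomorphic_near0_iff by fast
  then show ?thesis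
    using uv(1,2) unfolding analytic_at_iff_eventually
    by eventually_elim (rule complex_differentiable2_curve)
qed

lemma holomorphic_near0_fst: "holomorphic_near0 fst"
  and holomorphic_near0_snd: "holomorphic_near0 snd"
  by (simp_all add: holomorphic_near0_iff complex_differentiable2_fst complex_differentiable2_snd)

lemma holomorphic_near0_power: "holomorphic_near0 f \<Longrightarrow> holomorphic_near0 (\<lambda>p. f p ^ n)"
  by (induction n) (auto intro: holomorphic_near0_const holomorphic_near0_mult)

lemma holomorphic_near0_diff:
  "holomorphic_near0 f \<Longrightarrow> holomorphic_near0 g \<Longrightarrow> holomorphic_near0 (\<lambda>p. f p - g p)"
  using holomorphic_near0_add[OF _ holomorphic_near0_uminus] by fastforce

lemma holomorphic_near0_sum:
  "finite I \<Longrightarrow> (\<And>i. i \<in> I \<Longrightarrow> holomorphic_near0 (f i)) \<Longrightarrow> holomorphic_near0 (\<lambda>p. \<Sum>i\<in>I. f i p)"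
  by (induction I rule: finite_induct) (auto intro: holomorphic_near0_const holomorphic_near0_add)

lemma holomorphic_near0_prod:
  "finite I \<Longrightarrow> (\<And>i. i \<in> I \<Longrightarrow> holomorphic_near0 (f i)) \<Longrightarrow> holomorphic_near0 (\<lambda>p. \<Prod>i\<in>I. f i p)"
  by (induction I rule: finite_induct) (auto intro: holomorphic_near0_const holomorphic_near0_mult)

lemmas holomorphic_near0_intros =
  holomorphic_near0_const holomorphic_near0_fst holomorphic_near0_snd
  holomorphic_near0_add holomorphic_near0_diff holomorphic_near0_uminus holomorphic_near0_mult
  holomorphic_near0_power holomorphic_near0_sum holomorphic_near0_prod

section \<open>Descent along the power map\<close>

definition unity_root :: "nat \<Rightarrow> complex" where
  "unity_root d = cis (2 * pi / d)"

lemma norm_unity_root [simp]: "cmod (unity_root d) = 1"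
  by (simp add: unity_root_def)

lemma unity_root_nonzero [simp]: "unity_root d \<noteq> 0"
  by (simp add: unity_root_def)

lemma unity_root_power_self: "d > 0 \<Longrightarrow> unity_root d ^ d = 1"
  by (simp add: unity_root_def Complex.DeMoivre)

lemma unity_root_power_mult: "d > 0 \<Longrightarrow> e > 0 \<Longrightarrow> unity_root (d * e) ^ e = unity_root d"
  by (simp add: unity_root_def Complex.DeMoivre field_simps)

lemma same_power_imp_unity_root_mult:
  assumes "d > 0" "s ^ d = t ^ d"
  shows "\<exists>j<d. s = unity_root d ^ j * t"
proof (cases "t = 0")
  case True
  then show ?thesis using assms by (auto simp: power_0_left)
next
  case False
  then have "(s / t) ^ d = 1" using assms(2) by (simp add: power_divide)
  then have "s / t \<in> {exp (2 * of_real pi * \<i> * of_nat j / of_nat d) | j. j < d}"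
    using complex_roots_unity[of d] assms(1) by auto
  then obtain j where j: "j < d" "s / t = exp (2 * of_real pi * \<i> * of_nat j / of_nat d)" by blast
  have "s / t = unity_root d ^ j"
    unfolding j(2) unity_root_def Complex.DeMoivre by (simp add: cis_conv_exp field_simps)
  then show ?thesis using False j(1) by (auto simp: field_simps)
qed

lemma root_powr_power:
  "d > 0 \<Longrightarrow> ((x :: complex) powr (1 / of_nat d)) ^ d = x"
  by (cases "x = 0") (auto simp: powr_def simp flip: exp_of_nat_mult)

lemma norm_root_powr: "d > 0 \<Longrightarrow> cmod (x powr (1 / of_nat d)) = root d (cmod x)"
  using root_powr_power[of d x] by (metis norm_ge_zero norm_power real_root_power_cancel)

lemma filterlim_root_powr:
  assumes "d > 0"
  shows "filterlim (\<lambda>x :: complex. x powr (1 / of_nat d)) (nhds 0) (nhds 0)"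
proof -
  have "isCont (\<lambda>x :: complex. root d (cmod x)) 0"
    by (intro continuous_intros)
  then have "((\<lambda>x :: complex. root d (cmod x)) \<longlongrightarrow> root d (cmod 0)) (nhds 0)"
    using tendsto_at_iff_tendsto_nhds[of "\<lambda>x :: complex. root d (cmod x)" 0] by (simp add: isCont_def)
  then show ?thesis
    by (intro tendsto_norm_zero_cancel[of "\<lambda>x. x powr (1 / of_nat d)"])
      (simp add: norm_root_powr[OF assms])
qed

text \<open>A property of points near the origin may be checked on the points \<open>(t^d, y)\<close>, since small \<open>x\<close>
  have small \<open>d\<close>-th roots.\<close>

lemma eventually_nhds_0_power:
  assumes "d > 0" "\<forall>\<^sub>F p in nhds 0. Q (fst p ^ d, snd p)"
  shows "\<forall>\<^sub>F p in nhds (0 :: complex \<times> complex). Q p"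
proof -
  have "filterlim (\<lambda>p :: complex \<times> complex. (fst p powr (1 / of_nat d), snd p)) (nhds 0) (nhds 0)"
    using tendsto_fst[of "\<lambda>p. p" 0 "nhds (0 :: complex \<times> complex)"]
      tendsto_snd[of "\<lambda>p. p" 0 "nhds (0 :: complex \<times> complex)"]
    by (intro filterlim_Pair_nhds_0 filterlim_compose[OF filterlim_root_powr[OF assms(1)]])
      (auto simp: filterlim_ident)
  from eventually_compose_filterlim[OF assms(2) this]
  show ?thesis by (simp add: root_powr_power[OF assms(1)])
qed

lemma eventually_nhds_0_power1:
  assumes "d > 0" "\<forall>\<^sub>F t in nhds 0. Q (t ^ d)"
  shows "\<forall>\<^sub>F x in nhds (0 :: complex). Q x"
  using eventually_compose_filterlim[OF assms(2) filterlim_root_powr[OF assms(1)]]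
  by (simp add: root_powr_power[OF assms(1)])

text \<open>A germ invariant under \<open>x \<mapsto> exp(2 \<pi> \<i> / d) x\<close> is a holomorphic function of \<open>(x^d, y)\<close>. Put
  \<open>F(x, y) = P(s, y)\<close> for any \<open>d\<close>-th root \<open>s\<close> of \<open>x\<close>; by invariance the choice does not matter. Where
  \<open>x \<noteq> 0\<close>, a local holomorphic branch of the root may be chosen, and continuity on the line \<open>x = 0\<close>
  makes the singularities there removable.\<close>

lemma holomorphic_near0_descend:
  assumes d: "d > 0" and P: "holomorphic_near0 P"
    and inv: "\<forall>\<^sub>F p in nhds 0. P (unity_root d * fst p, snd p) = P p"
  shows "\<exists>F. holomorphic_near0 F \<and> (\<forall>\<^sub>F p in nhds 0. P p = F (fst p ^ d, snd p))"
proof -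
  obtain r1 where r1: "r1 > 0" "\<forall>p\<in>ball 0 r1 \<times> ball 0 r1. complex_differentiable2 P p"
    using P unfolding holomorphic_near0_polydisc by auto
  obtain r2 where r2: "r2 > 0"
    "\<And>x y. x \<in> ball 0 r2 \<Longrightarrow> y \<in> ball 0 r2 \<Longrightarrow> P (unity_root d * x, y) = P (x, y)"
    using inv unfolding eventually_nhds_0_polydisc by auto
  define r where "r = min r1 r2"
  have r: "r > 0" and hol: "\<forall>p\<in>ball 0 r \<times> ball 0 r. complex_differentiable2 P p"
    and inv: "\<And>x y. x \<in> ball 0 r \<Longrightarrow> y \<in> ball 0 r \<Longrightarrow> P (unity_root d * x, y) = P (x, y)"
    using r1 r2 by (auto simp: r_def)
  have inv_power: "P (unity_root d ^ j * x, y) = P (x, y)"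
    if "x \<in> ball 0 r" "y \<in> ball 0 r" for j x y
  proof (induction j)
    case (Suc j)
    have "unity_root d ^ j * x \<in> ball 0 r" using that by (simp add: norm_mult norm_power)
    from inv[OF this that(2)] Suc show ?case by (simp add: mult.assoc)
  qed simp
  have same: "P (s, y) = P (t, y)" if "s ^ d = t ^ d" "t \<in> ball 0 r" "y \<in> ball 0 r" for s t y
    using same_power_imp_unity_root_mult[OF d that(1)] inv_power[OF that(2,3)] by auto
  let ?rt = "\<lambda>x :: complex. x powr (1 / of_nat d)"
  note rt = root_powr_power[OF d]
  define F where "F p = P (?rt (fst p), snd p)" for p
  have rt_ball: "?rt x \<in> ball 0 r" if "x \<in> ball 0 (r ^ d)" for x
  proof -
    have "cmod (?rt x) ^ d < r ^ d" using that by (simp add: rt flip: norm_power)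
    then show ?thesis using r power_less_imp_less_base[of _ d r] by simp
  qed
  have F_off0: "complex_differentiable2 F (x0, y0)"
    if x0: "x0 \<in> ball 0 (r ^ d)" "x0 \<noteq> 0" and y0: "y0 \<in> ball 0 r" for x0 y0
  proof -
    \<comment> \<open>The principal root jumps across the negative axis; this branch is holomorphic around \<open>x0\<close>,
        because \<open>x / x0\<close> is near 1.\<close>
    define \<rho> where "\<rho> x = ?rt x0 * ?rt (x / x0)" for x
    have \<rho>: "\<rho> x ^ d = x" for x
      using x0 by (simp add: \<rho>_def power_mult_distrib rt)
    have "\<forall>\<^sub>F p in nhds (x0, y0). F p = P (\<rho> (fst p), snd p)"
      unfolding eventually_nhds
    proof (intro exI conjI ballI)
      show "open (ball 0 (r ^ d) \<times> ball (0 :: complex) r)" by (intro open_Times) auto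
      show "(x0, y0) \<in> ball 0 (r ^ d) \<times> ball 0 r" using x0 y0 by auto
      fix p :: "complex \<times> complex" assume "p \<in> ball 0 (r ^ d) \<times> ball 0 r"
      then show "F p = P (\<rho> (fst p), snd p)"
        unfolding F_def using same[of "\<rho> (fst p)" "?rt (fst p)" "snd p"] rt_ball[of "fst p"] rt \<rho>
        by (auto simp: mem_Times_iff)
    qed
    moreover have "complex_differentiable2 (\<lambda>p. P (\<rho> (fst p), snd p)) (x0, y0)"
    proof (rule complex_differentiable2_compose)
      have "\<rho> x0 = ?rt x0" using x0 by (simp add: \<rho>_def)
      then show "complex_differentiable2 P (\<rho> (fst (x0, y0)), snd (x0, y0))"
        using hol rt_ball[OF x0(1)] y0 by simp
      have "((\<lambda>z. z powr (1 / of_nat d)) \<circ> (\<lambda>x. x / x0)) field_differentiable at x0"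
      proof (rule field_differentiable_compose)
        show "(\<lambda>x. x / x0) field_differentiable at x0"
          using x0(2) by (intro derivative_intros) auto
        show "(\<lambda>z. z powr (1 / of_nat d)) field_differentiable at (x0 / x0)"
          unfolding field_differentiable_def
          using has_field_derivative_powr[of "x0 / x0" "1 / of_nat d"] x0(2) by auto
      qed
      then have "\<rho> field_differentiable at x0"
        unfolding \<rho>_def o_def by (intro derivative_intros)
      then show "complex_differentiable2 (\<lambda>p. \<rho> (fst p)) (x0, y0)"
        using complex_differentiable2_compose1[of \<rho> fst "(x0, y0)"] complex_differentiable2_fst
        by simp
    qed (rule complex_differentiable2_snd)
    ultimately show ?thesis by (simp add: complex_differentiable2_cong)
  qed
  have cont: "continuous_on (ball 0 (r ^ d) \<times> ball 0 r) F"
  proof (intro continuous_at_imp_continuous_on ballI)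
    fix p :: "complex \<times> complex" assume p: "p \<in> ball 0 (r ^ d) \<times> ball 0 r"
    obtain x0 y0 where xy: "p = (x0, y0)" by force
    show "isCont F p"
    proof (cases "x0 = 0")
      case False
      then show ?thesis using F_off0[of x0 y0] p xy complex_differentiable2_imp_isCont by simp
    next
      case True
      have "filterlim (\<lambda>p. ?rt (fst p)) (nhds 0) (nhds (0, y0))"
        using tendsto_fst[of "\<lambda>p. p" "(0, y0)" "nhds (0 :: complex, y0)"]
        by (intro filterlim_compose[OF filterlim_root_powr[OF d]]) (simp add: filterlim_ident)
      moreover have "filterlim snd (nhds y0) (nhds (0 :: complex, y0))"
        using tendsto_snd[of "\<lambda>p. p" "(0, y0)" "nhds (0 :: complex, y0)"] by (simp add: filterlim_ident)
      ultimately have "filterlim (\<lambda>p. (?rt (fst p), snd p)) (nhds (0, y0)) (nhds (0, y0))"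
        by (rule tendsto_Pair)
      moreover have "filterlim P (nhds (P (0, y0))) (nhds (0, y0))"
        using hol p xy r complex_differentiable2_imp_isCont[of P "(0, y0)"]
        by (simp add: isCont_def tendsto_at_iff_tendsto_nhds)
      ultimately have "filterlim F (nhds (P (0, y0))) (nhds (0, y0))"
        unfolding F_def by (rule filterlim_compose[rotated])
      then show ?thesis
        using True xy tendsto_mono[OF at_within_le_nhds] by (auto simp: isCont_def F_def)
    qed
  qed
  have rd: "r ^ d > 0" using r by simp
  have "complex_differentiable2 F p" if "p \<in> ball 0 (r ^ d) \<times> ball 0 r" for p
  proof (rule osgood[OF open_ball open_ball convex_ball cont _ _ that])
    fix y assume y: "y \<in> ball (0 :: complex) r"
    show "(\<lambda>w. F (w, y)) holomorphic_on ball 0 (r ^ d)"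
    proof (rule no_isolated_singularity[where K = "{0}"])
      show "continuous_on (ball 0 (r ^ d)) (\<lambda>w. F (w, y))"
        using y by (intro continuous_on_compose2[OF cont] continuous_intros) auto
      show "(\<lambda>w. F (w, y)) holomorphic_on ball 0 (r ^ d) - {0}"
        unfolding holomorphic_on_def
      proof
        fix x :: complex assume "x \<in> ball 0 (r ^ d) - {0}"
        then show "(\<lambda>w. F (w, y)) field_differentiable at x within ball 0 (r ^ d) - {0}"
          using F_off0[OF _ _ y, of x] complex_differentiable2_curve[of F "\<lambda>w. w" x "\<lambda>w. y"]
          by (simp add: field_differentiable_at_within)
      qed
    qed auto
  next
    fix x assume x: "x \<in> ball (0 :: complex) (r ^ d)"
    show "(\<lambda>w. F (x, w)) holomorphic_on ball 0 r"
      unfolding F_def fst_conv snd_conv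
      by (rule complex_differentiable2_slices(2)[OF hol rt_ball[OF x]])
  qed
  then have "holomorphic_near0 F"
    unfolding holomorphic_near0_polydisc using r rd
    by (intro exI[of _ "min r (r ^ d)"]) auto
  moreover have "P (x, y) = F (x ^ d, y)" if "x \<in> ball 0 r" "y \<in> ball 0 r" for x y
    unfolding F_def fst_conv snd_conv by (rule same[symmetric, OF _ that]) (simp add: rt)
  ultimately show ?thesis
    unfolding eventually_nhds_0_polydisc using r
    by (intro exI[of _ F] conjI exI[of _ r]) auto
qed

section \<open>Implicit functions and Taylor expansion in the second variable\<close>

text \<open>Newton's method with the fixed slope \<open>b = \<partial>f/\<partial>y (0, 0)\<close>: for small \<open>x\<close> the map
  \<open>y \<mapsto> y - f(x, y) / b\<close> is a contraction by 1/2 of a small disc into itself, and its fixed points are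
  the zeros of \<open>f(x, \<cdot>)\<close>. The iterates that start at 0 are holomorphic in \<open>x\<close> and converge uniformly
  to the fixed point, which is therefore holomorphic in \<open>x\<close> as well.\<close>

lemma holomorphic_implicit_function:
  assumes f: "holomorphic_near0 f" and f0: "f 0 = 0" and D0: "deriv_snd f 0 \<noteq> 0"
  shows "\<exists>\<psi>. \<psi> analytic_on {0} \<and> \<psi> 0 = 0 \<and> (\<forall>\<^sub>F x in nhds 0. f (x, \<psi> x) = 0)"
proof -
  define b where "b = deriv_snd f 0"
  have b: "b \<noteq> 0" using D0 by (simp add: b_def)
  have "\<forall>\<^sub>F p in nhds 0. dist (deriv_snd f p) b < cmod b / 2"
    using holomorphic_near0_imp_filterlim[OF holomorphic_near0_deriv_snd[OF f]] b unfolding b_def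
    by (intro tendstoD) auto
  then have "\<forall>\<^sub>F p in nhds 0. complex_differentiable2 f p \<and> dist (deriv_snd f p) b < cmod b / 2"
    using f unfolding holomorphic_near0_iff by eventually_elim simp
  then obtain \<delta> where \<delta>: "\<delta> > 0" and
    "\<forall>x\<in>ball 0 \<delta>. \<forall>y\<in>ball 0 \<delta>. complex_differentiable2 f (x, y) \<and> dist (deriv_snd f (x, y)) b < cmod b / 2"
    unfolding eventually_nhds_0_polydisc by blast
  then have hol: "\<forall>p\<in>ball 0 \<delta> \<times> ball 0 \<delta>. complex_differentiable2 f p"
    and D: "\<And>x y. x \<in> ball 0 \<delta> \<Longrightarrow> y \<in> ball 0 \<delta> \<Longrightarrow> cmod (deriv_snd f (x, y) - b) \<le> cmod b / 2"
    by (auto simp: dist_norm less_imp_le)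
  note sl = complex_differentiable2_slices[OF hol]
  have "(\<lambda>x. f (x, 0)) analytic_on {0}"
    by (rule holomorphic_near0_curve[OF f]) (auto intro: analytic_intros)
  then have "((\<lambda>x. f (x, 0)) \<longlongrightarrow> 0) (nhds 0)"
    using analytic_at_imp_filterlim[of "\<lambda>x. f (x, 0)" 0] f0 by (simp add: zero_prod_def)
  then have "\<forall>\<^sub>F x in nhds 0. dist (f (x, 0)) 0 < cmod b * \<delta> / 4"
    by (rule tendstoD) (use b \<delta> in simp)
  then obtain s0 where s0: "s0 > 0" "\<And>x. dist x 0 < s0 \<Longrightarrow> dist (f (x, 0)) 0 < cmod b * \<delta> / 4"
    unfolding eventually_nhds_metric by blast
  define s where "s = min s0 \<delta>"
  have s: "s > 0" "\<And>x. x \<in> ball 0 s \<Longrightarrow> x \<in> ball 0 \<delta>"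
    "\<And>x. x \<in> ball 0 s \<Longrightarrow> cmod (f (x, 0)) \<le> cmod b * \<delta> / 4"
    using s0 \<delta> by (auto simp: s_def less_imp_le)
  define T where "T x y = y - f (x, y) / b" for x y
  have T_lip: "cmod (T x u - T x v) \<le> cmod (u - v) / 2"
    if "x \<in> ball 0 s" "u \<in> ball 0 \<delta>" "v \<in> ball 0 \<delta>" for x u v
  proof -
    have "cmod (f (x, u) - f (x, v) - (u - v) * b) \<le> cmod b / 2 * cmod (u - v)"
      by (rule deriv_snd_increment_bound[OF open_ball sl(2) convex_ball]) (use that s(2)[OF that(1)] D in auto)
    moreover have "T x u - T x v = - ((f (x, u) - f (x, v) - (u - v) * b) / b)"
      using b by (simp add: T_def field_simps)
    then have "cmod (T x u - T x v) = cmod (f (x, u) - f (x, v) - (u - v) * b) / cmod b"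
      by (simp only: norm_minus_cancel norm_divide)
    ultimately show ?thesis
      using b by (simp add: divide_le_eq mult.commute)
  qed
  let ?C = "cball (0 :: complex) (\<delta> / 2)"
  have C: "y \<in> ball 0 \<delta>" if "y \<in> ?C" for y using that \<delta> by auto
  have T_C: "T x y \<in> ?C" if x: "x \<in> ball 0 s" and y: "y \<in> ?C" for x y
  proof -
    have "cmod (T x 0) \<le> \<delta> / 4"
      using s(3)[OF x] b by (simp add: T_def norm_divide divide_le_eq field_simps)
    moreover have "cmod (T x y - T x 0) \<le> \<delta> / 4"
      using T_lip[OF x C[OF y], of 0] y \<delta> by simp
    ultimately show ?thesis using norm_triangle_sub[of "T x y" "T x 0"] by simp
  qed
  have "\<exists>!y\<in>?C. T x y = y" if x: "x \<in> ball 0 s" for x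
  proof (rule Banach_fix[of _ "1 / 2"])
    show "dist (T x u) (T x v) \<le> 1 / 2 * dist u v" if "u \<in> ?C" "v \<in> ?C" for u v
      using T_lip[OF x C C] that by (simp add: dist_norm)
  qed (use \<delta> T_C[OF x] in \<open>auto simp: complete_eq_closed\<close>)
  then have "\<exists>y. \<forall>x\<in>ball 0 s. y x \<in> ?C \<and> T x (y x) = y x"
    by (intro bchoice) blast
  then obtain \<psi> where \<psi>: "\<And>x. x \<in> ball 0 s \<Longrightarrow> \<psi> x \<in> ?C"
    "\<And>x. x \<in> ball 0 s \<Longrightarrow> T x (\<psi> x) = \<psi> x" by blast
  have root: "f (x, \<psi> x) = 0" if "x \<in> ball 0 s" for x
    using \<psi>(2)[OF that] b by (simp add: T_def)
  have "cmod (T 0 (\<psi> 0) - T 0 0) \<le> cmod (\<psi> 0 - 0) / 2"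
    using T_lip[of 0 "\<psi> 0" 0] C[OF \<psi>(1)[of 0]] s(1) \<delta> by simp
  moreover have "T 0 0 = 0" using f0 by (simp add: T_def zero_prod_def)
  ultimately have \<psi>0: "\<psi> 0 = 0" using \<psi>(2)[of 0] s(1) by simp
  define it where "it n x = (T x ^^ n) 0" for n x
  have it_C: "it n x \<in> ?C" if "x \<in> ball 0 s" for n x
    by (induction n) (use \<delta> T_C[OF that] in \<open>auto simp: it_def\<close>)
  have it_hol: "it n holomorphic_on ball 0 s" for n
  proof (induction n)
    case 0
    then show ?case by (simp add: it_def holomorphic_on_const)
  next
    case (Suc n)
    have "(\<lambda>x. f (x, it n x)) holomorphic_on ball 0 s"
      unfolding holomorphic_on_def
    proof
      fix x :: complex assume x: "x \<in> ball 0 s"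
      have "(\<lambda>x. f (x, it n x)) field_differentiable at x"
        using complex_differentiable2_curve[of f "\<lambda>w. w" x "it n"] hol s(2)[OF x] C[OF it_C[OF x]]
          holomorphic_on_imp_differentiable_at[OF Suc open_ball x] by simp
      then show "(\<lambda>x. f (x, it n x)) field_differentiable at x within ball 0 s"
        by (rule field_differentiable_at_within)
    qed
    moreover have "it (Suc n) = (\<lambda>x. it n x - f (x, it n x) / b)"
      by (simp add: it_def T_def fun_eq_iff)
    ultimately show ?case using Suc b by (auto intro!: holomorphic_intros)
  qed
  have it_close: "cmod (it n x - \<psi> x) \<le> \<delta> * (1 / 2) ^ n" if x: "x \<in> ball 0 s" for n x
  proof (induction n)
    case 0
    then show ?case using C[OF \<psi>(1)[OF x]] by (simp add: it_def)
  next
    case (Suc n)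
    have "cmod (T x (it n x) - T x (\<psi> x)) \<le> cmod (it n x - \<psi> x) / 2"
      by (rule T_lip[OF x C[OF it_C[OF x]] C[OF \<psi>(1)[OF x]]])
    then show ?case using Suc \<psi>(2)[OF x] by (simp add: it_def)
  qed
  have lim: "uniform_limit (ball 0 s) it \<psi> sequentially"
  proof (rule uniform_limitI)
    fix e :: real assume "e > 0"
    have "(\<lambda>n. \<delta> * (1 / 2) ^ n) \<longlonglongrightarrow> \<delta> * 0"
      by (intro tendsto_intros LIMSEQ_realpow_zero) auto
    then have "\<forall>\<^sub>F n in sequentially. \<delta> * (1 / 2) ^ n < e"
      using order_tendstoD(2) \<open>e > 0\<close> by fastforce
    then show "\<forall>\<^sub>F n in sequentially. \<forall>x\<in>ball 0 s. dist (it n x) (\<psi> x) < e"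
    proof eventually_elim
      case (elim n)
      then show ?case using le_less_trans[OF it_close elim] by (simp add: dist_norm)
    qed
  qed
  have "\<psi> holomorphic_on ball 0 s"
  proof (rule holomorphic_uniform_sequence[OF open_ball it_hol])
    fix x :: complex assume "x \<in> ball 0 s"
    then obtain d where "d > 0" "cball x d \<subseteq> ball 0 s"
      using open_ball open_contains_cball by blast
    then show "\<exists>d>0. cball x d \<subseteq> ball 0 s \<and> uniform_limit (cball x d) it \<psi> sequentially"
      using uniform_limit_on_subset[OF lim] by blast
  qed
  then have "\<psi> analytic_on {0}" using s(1) unfolding analytic_at by (metis open_ball centre_in_ball)
  moreover have "\<forall>\<^sub>F x in nhds 0. f (x, \<psi> x) = 0"
    using root s(1) unfolding eventually_nhds by (intro exI[of _ "ball 0 s"]) auto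
  ultimately show ?thesis using \<psi>0 by blast
qed

lemma higher_deriv_of_expansion:
  fixes g h :: "complex \<Rightarrow> complex"
  assumes g: "g analytic_on {0}"
    and h: "\<forall>\<^sub>F y in nhds 0. h y = (\<Sum>j<n. c j * y ^ j) + y ^ n * g y"
  shows "(deriv ^^ n) h 0 = fact n * g 0"
    and "j < n \<Longrightarrow> (deriv ^^ j) h 0 = fact j * c j"
proof -
  define G where "G = fps_expansion g 0"
  have G: "g has_fps_expansion G"
    using g has_fps_expansion_fps_expansion unfolding G_def analytic_at by blast
  have "(\<lambda>y. (\<Sum>j<n. c j * y ^ j) + y ^ n * g y) has_fps_expansion
      (\<Sum>j<n. fps_const (c j) * fps_X ^ j) + fps_X ^ n * G"
    by (intro fps_expansion_intros G)
  then have H: "h has_fps_expansion (\<Sum>j<n. fps_const (c j) * fps_X ^ j) + fps_X ^ n * G"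
    using has_fps_expansion_cong[OF h refl] by simp
  have G0: "fps_nth G 0 = g 0" by (simp add: G_def fps_expansion_def)
  have "(deriv ^^ i) h 0 = fact i * fps_nth ((\<Sum>j<n. fps_const (c j) * fps_X ^ j) + fps_X ^ n * G) i" for i
    using fps_nth_fps_expansion[OF H, of i] by simp
  then show "(deriv ^^ n) h 0 = fact n * g 0" "j < n \<Longrightarrow> (deriv ^^ j) h 0 = fact j * c j"
    by (auto simp: fps_sum_nth fps_X_power_mult_nth fps_X_power_nth G0 if_distrib cong: if_cong)
qed

lemma deriv_snd_funpow:
  "(deriv_snd ^^ n) f (x, y) = (deriv ^^ n) (\<lambda>w. f (x, w)) y"
  by (induction n arbitrary: y) (simp_all add: deriv_snd_def)

lemma holomorphic_near0_deriv_snd_funpow: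
  "holomorphic_near0 f \<Longrightarrow> holomorphic_near0 ((deriv_snd ^^ n) f)"
  by (induction n) (auto intro: holomorphic_near0_deriv_snd)

lemma eventually_nhds_0_slices:
  assumes "\<forall>\<^sub>F p in nhds (0 :: complex \<times> complex). Q p"
  shows "\<forall>\<^sub>F x in nhds 0. \<forall>\<^sub>F y in nhds 0. Q (x, y)"
proof -
  obtain r where "r > 0" "\<forall>x\<in>ball 0 r. \<forall>y\<in>ball 0 r. Q (x, y)"
    using assms unfolding eventually_nhds_0_polydisc by blast
  then show ?thesis
    unfolding eventually_nhds by (metis centre_in_ball open_ball)
qed

lemma eventually_nhds_0_fst:
  assumes "\<forall>\<^sub>F x in nhds (0 :: complex). Q x"
  shows "\<forall>\<^sub>F p in nhds (0 :: complex \<times> complex). Q (fst p)"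
  using eventually_compose_filterlim[OF assms holomorphic_near0_imp_filterlim[OF holomorphic_near0_fst, simplified]] .

lemma holomorphic_near0_slices:
  assumes "holomorphic_near0 f"
  shows "\<forall>\<^sub>F x in nhds 0. (\<lambda>y. f (x, y)) analytic_on {0}"
    and "(\<lambda>x. f (x, 0)) analytic_on {0}"
proof -
  obtain r where r: "r > 0" "\<forall>p\<in>ball 0 r \<times> ball 0 r. complex_differentiable2 f p"
    using assms unfolding holomorphic_near0_polydisc by auto
  note sl = complex_differentiable2_slices[OF r(2)]
  have "\<forall>\<^sub>F x in nhds (0 :: complex). x \<in> ball 0 r" 
    using r(1) by (intro eventually_nhds_in_open) auto
  then show "\<forall>\<^sub>F x in nhds 0. (\<lambda>y. f (x, y)) analytic_on {0}"
    by eventually_elim (use r(1) sl(2) in \<open>auto simp: analytic_at intro: exI[of _ "ball 0 r"]\<close>)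
  show "(\<lambda>x. f (x, 0)) analytic_on {0}"
    using r(1) sl(1)[of 0] by (auto simp: analytic_at intro: exI[of _ "ball 0 r"])
qed

text \<open>Each step divides \<open>g(x, y) - g(x, 0)\<close> by \<open>y\<close>; comparing power series in \<open>y\<close> for each fixed \<open>x\<close>
  shows that \<open>g(x, 0)\<close> is the next Taylor coefficient.\<close>

lemma holomorphic_near0_taylor_snd:
  assumes f: "holomorphic_near0 f"
  shows "\<exists>g. holomorphic_near0 g \<and> (\<forall>\<^sub>F p in nhds 0.
    f p = (\<Sum>j<n. (deriv_snd ^^ j) f (fst p, 0) / fact j * snd p ^ j) + snd p ^ n * g p)"
proof (induction n)
  case 0
  then show ?case using f by auto
next
  case (Suc n)
  then obtain g where g: "holomorphic_near0 g" and eq: "\<forall>\<^sub>F p in nhds 0.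
    f p = (\<Sum>j<n. (deriv_snd ^^ j) f (fst p, 0) / fact j * snd p ^ j) + snd p ^ n * g p"
    by blast
  have "\<forall>\<^sub>F x in nhds 0. (deriv_snd ^^ n) f (x, 0) = fact n * g (x, 0)"
    using eventually_nhds_0_slices[OF eq] holomorphic_near0_slices(1)[OF g]
    unfolding deriv_snd_funpow fst_conv snd_conv
    by eventually_elim (rule higher_deriv_of_expansion(1))
  then have coeff: "\<forall>\<^sub>F p in nhds (0 :: complex \<times> complex). (deriv_snd ^^ n) f (fst p, 0) = fact n * g (fst p, 0)"
    by (rule eventually_nhds_0_fst[where Q = "\<lambda>x. (deriv_snd ^^ n) f (x, 0) = fact n * g (x, 0)"])
  define k where "k p = g p - g (fst p, 0)" for p
  have "holomorphic_near0 k"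
    unfolding k_def by (intro holomorphic_near0_intros holomorphic_near0_compose g) auto
  then obtain g' where g': "holomorphic_near0 g'" "\<forall>\<^sub>F p in nhds 0. k p = snd p * g' p"
    using holomorphic_near0_divide_snd[of k] by (auto simp: k_def)
  have "\<forall>\<^sub>F p in nhds 0.
    f p = (\<Sum>j<Suc n. (deriv_snd ^^ j) f (fst p, 0) / fact j * snd p ^ j) + snd p ^ Suc n * g' p"
    using eq coeff g'(2)
  proof eventually_elim
    case (elim p)
    then have "g p = g (fst p, 0) + snd p * g' p" by (simp add: k_def algebra_simps)
    then show ?case using elim by (simp add: algebra_simps)
  qed
  then show ?case using g'(1) by blast
qed

section \<open>Existence of a Puiseux root\<close>

lemma analytic_at_zero_cases:
  assumes "\<phi> analytic_on {0}"
  obtains "\<forall>\<^sub>F x in nhds 0. \<phi> x = 0"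
  | v w where "w analytic_on {0}" "w 0 \<noteq> 0" "\<forall>\<^sub>F x in nhds 0. \<phi> x = x ^ v * w x"
proof -
  obtain r where r: "r > 0" "\<phi> holomorphic_on ball 0 r"
    using assms unfolding analytic_on_def by auto
  consider "\<phi> 0 \<noteq> 0" | "\<phi> 0 = 0" "\<phi> constant_on ball 0 r" | "\<phi> 0 = 0" "\<not> \<phi> constant_on ball 0 r"
    by blast
  then show thesis
  proof cases
    case 1
    then show thesis using that(2)[of \<phi> 0] assms by simp
  next
    case 2
    then have "\<phi> x = 0" if "x \<in> ball 0 r" for x
      using that r(1) unfolding constant_on_def by (metis centre_in_ball)
    then show thesis
      using that(1) r(1) unfolding eventually_nhds by (metis centre_in_ball open_ball)
  next
    case 3
    obtain g s n where g: "0 < s" "g holomorphic_on ball 0 s"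
        "\<And>w. w \<in> ball 0 s \<Longrightarrow> \<phi> w = (w - 0) ^ n * g w" "\<And>w. w \<in> ball 0 s \<Longrightarrow> g w \<noteq> 0"
      using holomorphic_factor_zero_nonconstant[OF r(2) open_ball connected_ball _ 3]
        r(1) by (metis centre_in_ball)
    show thesis
    proof (rule that(2))
      show "g analytic_on {0}"
        using g(1,2) unfolding analytic_at by (metis centre_in_ball open_ball)
      show "g 0 \<noteq> 0" using g(1,4) by simp
      show "\<forall>\<^sub>F x in nhds 0. \<phi> x = x ^ n * g x"
        unfolding eventually_nhds using g(1,3) by (intro exI[of _ "ball 0 s"]) auto
    qed
  qed
qed

text \<open>If a root \<open>z\<close> had multiplicity \<open>n\<close>, the polynomial would be \<open>c(X - z)^n\<close>, whose coefficient of
  \<open>X^(n-1)\<close> is \<open>- c n z\<close>. This forces \<open>z = 0\<close>, so that no term of lower degree is left.\<close>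

lemma poly_root_multiplicity_less_degree:
  fixes h :: "complex poly"
  assumes "degree h = n" "coeff h (n - 1) = 0" "j < n" "coeff h j \<noteq> 0"
  obtains z m q where "1 \<le> m" "m < n" "h = [:- z, 1:] ^ m * q" "poly q z \<noteq> 0"
proof -
  obtain z where z: "poly h z = 0" using alg_closed_imp_poly_has_root[of h] assms by auto
  have h0: "h \<noteq> 0" using assms by auto
  define m where "m = order z h"
  obtain q where q: "h = [:- z, 1:] ^ m * q" "\<not> [:- z, 1:] dvd q"
    using order_decomp[OF h0] unfolding m_def by blast
  have q0: "q \<noteq> 0" using h0 q by auto
  have deg: "n = m + degree q"
    using assms(1) q0 unfolding q(1) by (simp add: degree_mult_eq degree_power_eq)
  have m1: "1 \<le> m" using order_root[of h z] z h0 by (simp add: m_def Suc_leI)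
  have "m \<noteq> n"
  proof
    assume "m = n"
    then obtain c where c: "q = [:c:]" using deg degree_eq_zeroE[of q] by auto
    have h: "h = smult c ([:- z, 1:] ^ n)" using q(1) c \<open>m = n\<close> by simp
    have c0: "c \<noteq> 0" using c q0 by auto
    have n1: "n \<ge> 1" using m1 \<open>m = n\<close> by simp
    have "coeff h (n - 1) = c * (of_nat n * (- z))"
      using n1 binomial_symmetric[of "n - 1" n] by (simp add: h coeff_linear_poly_power)
    then have "z = 0" using assms(2) c0 n1 by simp
    then have "h = smult c (monom 1 n)" by (simp add: h monom_altdef)
    then show False using assms(3,4) by simp
  qed
  then show thesis
    using that[of m z q] m1 deg q poly_eq_0_iff_dvd by auto
qed

definition order_snd :: "(complex \<times> complex \<Rightarrow> complex) \<Rightarrow> nat \<Rightarrow> bool" where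
  "order_snd f n \<longleftrightarrow>
     (\<exists>u. u analytic_on {0} \<and> u 0 \<noteq> 0 \<and> (\<forall>\<^sub>F y in nhds 0. f (0, y) = y ^ n * u y))"

definition puiseux_root :: "(complex \<times> complex \<Rightarrow> complex) \<Rightarrow> nat \<Rightarrow> (complex \<Rightarrow> complex) \<Rightarrow> bool" where
  "puiseux_root f N \<phi> \<longleftrightarrow>
     N > 0 \<and> \<phi> analytic_on {0} \<and> \<phi> 0 = 0 \<and> (\<forall>\<^sub>F t in nhds 0. f (t ^ N, \<phi> t) = 0)"

text \<open>The inductive step for a germ whose coefficient of \<open>y^(n-1)\<close> vanishes. Write \<open>v j\<close> for the order
  of \<open>a j\<close>. The points \<open>(j, v j)\<close> lie on or above the line through \<open>(n, 0)\<close> of slope \<open>- p/q\<close>, where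
  \<open>p/q\<close> is the least \<open>v j / (n - j)\<close>. Hence \<open>f(t^q, t^p z)\<close> is divisible by \<open>t^(pn)\<close>, and the
  indices on the line, among them some \<open>j0 < n\<close>, are those that survive in the quotient at \<open>t = 0\<close>.\<close>

lemma newton_step:
  fixes a :: "nat \<Rightarrow> complex \<Rightarrow> complex"
  assumes IH: "\<And>m k. 1 \<le> m \<Longrightarrow> m < n \<Longrightarrow> holomorphic_near0 k \<Longrightarrow> order_snd k m \<Longrightarrow>
      \<exists>N \<phi>. puiseux_root k N \<phi>"
    and n: "n \<ge> 1" and g: "holomorphic_near0 g" "g 0 \<noteq> 0"
    and a: "\<And>j. j < n \<Longrightarrow> a j analytic_on {0}" "\<And>j. j < n \<Longrightarrow> a j 0 = 0"
    and a_last: "\<forall>\<^sub>F x in nhds 0. a (n - 1) x = 0"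
    and f: "\<forall>\<^sub>F p in nhds 0. f p = (\<Sum>j<n. a j (fst p) * snd p ^ j) + snd p ^ n * g p"
  shows "\<exists>N \<phi>. puiseux_root f N \<phi>"
proof (cases "\<forall>\<^sub>F x in nhds 0. a 0 x = 0")
  case True
  have "filterlim (\<lambda>t. (t, 0 :: complex)) (nhds 0) (nhds (0 :: complex))"
    by (rule filterlim_curve) (auto intro: analytic_intros)
  from eventually_compose_filterlim[OF f this] True
  have "\<forall>\<^sub>F t in nhds 0. f (t ^ 1, 0) = 0"
  proof eventually_elim
    case (elim t)
    then show ?case using n by (simp add: power_0_left sum.delta if_distrib cong: if_cong)
  qed
  then have "puiseux_root f 1 (\<lambda>_. 0)" by (simp add: puiseux_root_def)
  then show ?thesis by blast
next
  case False
  define J where "J = {j. j < n \<and> \<not> (\<forall>\<^sub>F x in nhds 0. a j x = 0)}"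
  have J: "finite J" "0 \<in> J" "n - 1 \<notin> J" "\<And>j. j \<in> J \<Longrightarrow> j < n"
    using False n a_last by (auto simp: J_def)
  have "\<exists>vw. snd vw analytic_on {0} \<and> snd vw 0 \<noteq> 0 \<and> (\<forall>\<^sub>F x in nhds 0. a j x = x ^ fst vw * snd vw x)"
    if "j \<in> J" for j
  proof -
    have "a j analytic_on {0}" using a(1) that by (simp add: J_def)
    then show ?thesis
      by (cases rule: analytic_at_zero_cases) (use that in \<open>auto simp: J_def\<close>)
  qed
  then obtain vw where vw: "\<forall>j\<in>J. snd (vw j) analytic_on {0} \<and> snd (vw j) 0 \<noteq> 0 \<and>
      (\<forall>\<^sub>F x in nhds 0. a j x = x ^ fst (vw j) * snd (vw j) x)"
    by metis
  define v w where "v = (\<lambda>j. fst (vw j))" and "w = (\<lambda>j. snd (vw j))"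
  have w: "w j analytic_on {0}" "w j 0 \<noteq> 0" "\<forall>\<^sub>F x in nhds 0. a j x = x ^ v j * w j x" if "j \<in> J" for j
    using vw that by (auto simp: v_def w_def)
  have v_pos: "v j > 0" if "j \<in> J" for j
    using eventually_nhds_x_imp_x[OF w(3)[OF that]] a(2)[OF J(4)[OF that]] w(2)[OF that] by (cases "v j") auto
  obtain j0 where j0: "j0 \<in> J" and
    min: "\<And>j. j \<in> J \<Longrightarrow> real (v j0) / real (n - j0) \<le> real (v j) / real (n - j)"
    using arg_min_if_finite(1)[OF J(1), of "\<lambda>j. real (v j) / real (n - j)"]
      arg_min_least[OF J(1), of _ "\<lambda>j. real (v j) / real (n - j)"] J(2) by blast
  \<comment> \<open>The fraction need not be in lowest terms, so numerator and denominator of the least slope serve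
      directly.\<close>
  define p q where "p = v j0" and "q = n - j0"
  have pq: "p > 0" "q > 0" using v_pos[OF j0] J(4)[OF j0] by (auto simp: p_def q_def)
  have slope: "p * (n - j) \<le> q * v j" if "j \<in> J" for j
  proof -
    have "real p * real (n - j) \<le> real q * real (v j)"
      using min[OF that] J(4)[OF that] J(4)[OF j0] by (simp add: p_def q_def field_simps)
    then show ?thesis by (metis of_nat_le_iff of_nat_mult)
  qed
  \<comment> \<open>The truncated subtraction in the exponent is exact by the choice of the slope, and it is 0
      for \<open>j = j0\<close>.\<close>
  define b where "b j t = (if j \<in> J then t ^ (q * v j - p * (n - j)) * w j (t ^ q) else 0)" for j t
  have b_an: "b j analytic_on {0}" for j
  proof (cases "j \<in> J")
    case True
    have "(w j \<circ> (\<lambda>t. t ^ q)) analytic_on {0}"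
      by (rule analytic_on_compose) (use w(1)[OF True] pq in \<open>auto intro!: analytic_intros simp: power_0_left\<close>)
    then show ?thesis using True by (auto simp: b_def[abs_def] o_def intro!: analytic_intros)
  qed (simp add: b_def[abs_def])
  have b_j0: "b j0 0 \<noteq> 0" and b_last: "b (n - 1) 0 = 0"
    using j0 w(2)[OF j0] pq J(3) by (auto simp: b_def p_def q_def power_0_left)
  define h where "h = (\<Sum>j<n. monom (b j 0) j) + monom (g 0) n"
  have coeff_h: "coeff h i = (if i < n then b i 0 else if i = n then g 0 else 0)" for i
    by (auto simp: h_def coeff_sum)
  have deg_h: "degree h = n"
    using g(2) coeff_h by (intro antisym degree_le le_degree) auto
  have "coeff h (n - 1) = 0" "coeff h j0 \<noteq> 0"
    using coeff_h b_last b_j0 J(4)[OF j0] n by auto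
  then obtain z0 m u where m: "1 \<le> m" "m < n" and h_eq: "h = [:- z0, 1:] ^ m * u" and u: "poly u z0 \<noteq> 0"
    using poly_root_multiplicity_less_degree[OF deg_h _ J(4)[OF j0]] by metis
  \<comment> \<open>The germ at \<open>(0, z0)\<close> of the quotient of \<open>f(t^q, t^p z)\<close> by \<open>t^(pn)\<close>.\<close>
  define k where "k r = (\<Sum>j<n. b j (fst r) * (z0 + snd r) ^ j) +
      (z0 + snd r) ^ n * g (fst r ^ q, fst r ^ p * (z0 + snd r))" for r
  have "holomorphic_near0 k"
  proof -
    have "holomorphic_near0 (\<lambda>r. b j (fst r))" for j
      by (rule holomorphic_near0_compose1[of "b j" fst]) (use b_an holomorphic_near0_fst in auto)
    moreover have "holomorphic_near0 (\<lambda>r. g (fst r ^ q, fst r ^ p * (z0 + snd r)))"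
      using pq by (intro holomorphic_near0_compose[of g "\<lambda>r. fst r ^ q" "\<lambda>r. fst r ^ p * (z0 + snd r)"]
          holomorphic_near0_intros g) (auto simp: power_0_left)
    ultimately show ?thesis
      unfolding k_def by (intro holomorphic_near0_intros) auto
  qed
  moreover have "order_snd k m"
    unfolding order_snd_def
  proof (intro exI[of _ "\<lambda>y. poly u (z0 + y)"] conjI always_eventually allI)
    have "((\<lambda>y. poly u (z0 + y)) has_field_derivative poly (pderiv u) (z0 + y) * 1) (at y)" for y
      by (rule DERIV_chain2[OF poly_DERIV]) (auto intro!: derivative_eq_intros)
    then show "(\<lambda>y. poly u (z0 + y)) analytic_on {0}"
      unfolding analytic_at_iff_eventually field_differentiable_def
      by (intro always_eventually) blast
    show "poly u (z0 + 0) \<noteq> 0" using u by simp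
    fix y
    have "k (0, y) = poly h (z0 + y)"
      using pq by (simp add: k_def h_def poly_sum poly_monom power_0_left mult.commute zero_prod_def)
    then show "k (0, y) = y ^ m * poly u (z0 + y)"
      by (simp add: h_eq poly_power)
  qed
  ultimately obtain M \<eta> where M: "M > 0" and \<eta>: "\<eta> analytic_on {0}" "\<eta> 0 = 0"
    and k0: "\<forall>\<^sub>F s in nhds 0. k (s ^ M, \<eta> s) = 0"
    using IH[OF m] unfolding puiseux_root_def by blast
  define \<phi> where "\<phi> s = s ^ (M * p) * (z0 + \<eta> s)" for s
  have \<phi>: "\<phi> analytic_on {0}" "\<phi> 0 = 0"
    using \<eta> pq M unfolding \<phi>_def by (auto intro!: analytic_intros simp: power_0_left)
  have lim1: "filterlim (\<lambda>s :: complex. s ^ (M * q)) (nhds 0) (nhds 0)"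
    using analytic_at_imp_filterlim[of "\<lambda>s :: complex. s ^ (M * q)" 0] M pq
    by (simp add: analytic_intros power_0_left)
  have lim2: "filterlim (\<lambda>s. (s ^ (M * q), \<phi> s)) (nhds 0) (nhds 0)"
    by (rule filterlim_curve) (use M pq \<phi> in \<open>auto intro: analytic_intros simp: power_0_left\<close>)
  have "\<forall>j\<in>{..<n}. \<forall>\<^sub>F x in nhds 0. a j x = (if j \<in> J then x ^ v j * w j x else 0)"
  proof
    fix j assume "j \<in> {..<n}"
    then show "\<forall>\<^sub>F x in nhds 0. a j x = (if j \<in> J then x ^ v j * w j x else 0)"
      using w(3)[of j] by (cases "j \<in> J") (auto simp: J_def)
  qed
  then have "\<forall>\<^sub>F x in nhds 0. \<forall>j\<in>{..<n}. a j x = (if j \<in> J then x ^ v j * w j x else 0)"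
    by (simp add: eventually_ball_finite_distrib)
  from eventually_compose_filterlim[OF this lim1] eventually_compose_filterlim[OF f lim2] k0
  have "\<forall>\<^sub>F s in nhds 0. f (s ^ (M * q), \<phi> s) = 0"
  proof eventually_elim
    case (elim s)
    define t z where "t = s ^ M" and "z = z0 + \<eta> s"
    have tq: "s ^ (M * q) = t ^ q" and \<phi>z: "\<phi> s = t ^ p * z"
      by (simp_all add: t_def z_def \<phi>_def power_mult)
    have aj: "a j (t ^ q) * (t ^ p * z) ^ j = t ^ (p * n) * (b j t * z ^ j)" if "j < n" for j
    proof (cases "j \<in> J")
      case True
      have "q * v j + p * j = p * n + (q * v j - p * (n - j))"
        using slope[OF True] that by (simp add: diff_mult_distrib2)
      then have "t ^ (q * v j) * t ^ (p * j) = t ^ (p * n) * t ^ (q * v j - p * (n - j))"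
        by (simp flip: power_add)
      then show ?thesis
        using elim(1) that True tq
        by (simp add: b_def power_mult_distrib power_mult[symmetric] mult_ac)
    next
      case False
      then show ?thesis using elim(1) that tq by (simp add: b_def)
    qed
    have "f (s ^ (M * q), \<phi> s) = (\<Sum>j<n. a j (t ^ q) * (t ^ p * z) ^ j) + (t ^ p * z) ^ n * g (t ^ q, t ^ p * z)"
      using elim(2) unfolding tq \<phi>z by simp
    also have "(\<Sum>j<n. a j (t ^ q) * (t ^ p * z) ^ j) = t ^ (p * n) * (\<Sum>j<n. b j t * z ^ j)"
      unfolding sum_distrib_left by (intro sum.cong aj) auto
    also have "(t ^ p * z) ^ n = t ^ (p * n) * z ^ n"
      by (simp add: power_mult_distrib power_mult)
    also have "t ^ (p * n) * (\<Sum>j<n. b j t * z ^ j) + t ^ (p * n) * z ^ n * g (t ^ q, t ^ p * z)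
        = t ^ (p * n) * k (t, \<eta> s)"
      unfolding k_def fst_conv snd_conv z_def by (simp only: distrib_left mult.assoc)
    finally show ?case using elim(3) by (simp add: t_def)
  qed
  then have "puiseux_root f (M * q) \<phi>"
    using \<phi> M pq by (simp add: puiseux_root_def)
  then show ?thesis by blast
qed

text \<open>The \<open>(n-1)\<close>-st derivative of \<open>f\<close> in \<open>y\<close> has a simple zero in \<open>y\<close> at the origin, so the implicit
  function theorem gives \<open>\<psi>\<close> on whose graph it vanishes. Recentring \<open>y\<close> at \<open>\<psi>(x)\<close> removes the term
  in \<open>y^(n-1)\<close> and keeps the order of \<open>f(0, y)\<close>.\<close>

lemma puiseux_root_exists:
  assumes "n \<ge> 1" "holomorphic_near0 f" "order_snd f n"
  shows "\<exists>N \<phi>. puiseux_root f N \<phi>"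
  using assms
proof (induction n arbitrary: f rule: less_induct)
  case (less n)
  note f = less.prems(2)
  obtain u where u: "u analytic_on {0}" "u 0 \<noteq> 0" "\<forall>\<^sub>F y in nhds 0. f (0, y) = y ^ n * u y"
    using less.prems(3) unfolding order_snd_def by blast
  have expansion: "\<forall>\<^sub>F y in nhds 0. f (0, y) = (\<Sum>j<n. 0 * y ^ j) + y ^ n * u y"
    using u(3) by simp
  have low: "(deriv_snd ^^ j) f (0, 0) = 0" if "j < n" for j
    using higher_deriv_of_expansion(2)[OF u(1) expansion that] by (simp add: deriv_snd_funpow)
  have top: "(deriv_snd ^^ n) f (0, 0) = fact n * u 0"
    using higher_deriv_of_expansion(1)[OF u(1) expansion] by (simp add: deriv_snd_funpow)
  define d where "d = (deriv_snd ^^ (n - 1)) f"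
  have d: "holomorphic_near0 d" "d 0 = 0"
    using f low[of "n - 1"] less.prems(1)
    by (simp_all add: d_def holomorphic_near0_deriv_snd_funpow zero_prod_def)
  have "deriv_snd d = (deriv_snd ^^ n) f"
    using less.prems(1) by (cases n) (auto simp: d_def)
  then have "deriv_snd d 0 \<noteq> 0" using top u(2) by (simp add: zero_prod_def)
  then obtain \<psi> where \<psi>: "\<psi> analytic_on {0}" "\<psi> 0 = 0" "\<forall>\<^sub>F x in nhds 0. d (x, \<psi> x) = 0"
    using holomorphic_implicit_function[OF d] by blast
  define f1 where "f1 r = f (fst r, snd r + \<psi> (fst r))" for r
  have f1: "holomorphic_near0 f1"
  proof -
    have "holomorphic_near0 (\<lambda>r. \<psi> (fst r))"
      by (rule holomorphic_near0_compose1[of \<psi> fst]) (use \<psi>(1) holomorphic_near0_fst in auto)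
    then show ?thesis
      unfolding f1_def using \<psi>(2)
      by (intro holomorphic_near0_compose[of f fst "\<lambda>r. snd r + \<psi> (fst r)"]
          holomorphic_near0_add holomorphic_near0_fst holomorphic_near0_snd f) auto
  qed
  have shift: "(deriv_snd ^^ j) f1 (x, y) = (deriv_snd ^^ j) f (x, y + \<psi> x)" for j x y
  proof (induction j arbitrary: y)
    case 0
    then show ?case by (simp add: f1_def)
  next
    case (Suc j)
    have "deriv (\<lambda>w. (deriv_snd ^^ j) f (x, w + \<psi> x)) y = deriv (\<lambda>w. (deriv_snd ^^ j) f (x, w)) (y + \<psi> x)"
      unfolding deriv_def using DERIV_shift[of "\<lambda>w. (deriv_snd ^^ j) f (x, w)" _ y "\<psi> x"] by simp
    moreover have "(\<lambda>w. (deriv_snd ^^ j) f1 (x, w)) = (\<lambda>w. (deriv_snd ^^ j) f (x, w + \<psi> x))"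
      using Suc by blast
    ultimately show ?case
      by (simp add: deriv_snd_def[of "(deriv_snd ^^ j) f1"] deriv_snd_def[of "(deriv_snd ^^ j) f"])
  qed
  obtain g where g: "holomorphic_near0 g" and tay: "\<forall>\<^sub>F p in nhds 0.
      f1 p = (\<Sum>j<n. (deriv_snd ^^ j) f1 (fst p, 0) / fact j * snd p ^ j) + snd p ^ n * g p"
    using holomorphic_near0_taylor_snd[OF f1] by blast
  define a where "a j x = (deriv_snd ^^ j) f1 (x, 0) / fact j" for j x
  have "(\<lambda>y. g (0, y)) analytic_on {0}"
    by (rule holomorphic_near0_curve[OF g]) (auto intro: analytic_intros)
  moreover have "\<forall>\<^sub>F y in nhds 0. f1 (0, y) = (\<Sum>j<n. a j 0 * y ^ j) + y ^ n * g (0, y)"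
    using eventually_nhds_x_imp_x[OF eventually_nhds_0_slices[OF tay]] by (simp add: a_def)
  ultimately have "(deriv ^^ n) (\<lambda>y. f1 (0, y)) 0 = fact n * g (0, 0)"
    by (rule higher_deriv_of_expansion(1))
  then have "g 0 \<noteq> 0"
    using shift[of n 0 0] top u(2) \<psi>(2) by (simp add: deriv_snd_funpow[symmetric] zero_prod_def)
  moreover have "\<exists>N \<phi>. puiseux_root k N \<phi>" if "1 \<le> m" "m < n" "holomorphic_near0 k" "order_snd k m" for m k
    using less.IH that by blast
  moreover have "a j analytic_on {0}" "a j 0 = 0" if "j < n" for j
  proof -
    show "a j analytic_on {0}"
      unfolding a_def
      by (intro analytic_intros holomorphic_near0_slices(2) holomorphic_near0_deriv_snd_funpow f1) auto
    show "a j 0 = 0" using low[OF that] shift[of j 0 0] \<psi>(2) by (simp add: a_def)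
  qed
  moreover have "\<forall>\<^sub>F x in nhds 0. a (n - 1) x = 0"
    using \<psi>(3) by eventually_elim (simp add: a_def shift d_def)
  ultimately obtain N \<phi> where "puiseux_root f1 N \<phi>"
    using newton_step[of n g a f1] less.prems(1) g tay unfolding a_def by blast
  then have N: "N > 0" and \<phi>: "\<phi> analytic_on {0}" "\<phi> 0 = 0" "\<forall>\<^sub>F t in nhds 0. f1 (t ^ N, \<phi> t) = 0"
    unfolding puiseux_root_def by auto
  have "(\<psi> \<circ> (\<lambda>t. t ^ N)) analytic_on {0}"
    by (rule analytic_on_compose) (use \<psi>(1) N in \<open>auto intro!: analytic_intros simp: power_0_left\<close>)
  then have "(\<lambda>t. \<phi> t + \<psi> (t ^ N)) analytic_on {0}"
    using \<phi>(1) by (auto simp: o_def intro!: analytic_intros)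
  moreover have "\<forall>\<^sub>F t in nhds 0. f (t ^ N, \<phi> t + \<psi> (t ^ N)) = 0"
    using \<phi>(3) by (simp add: f1_def)
  ultimately have "puiseux_root f N (\<lambda>t. \<phi> t + \<psi> (t ^ N))"
    using N \<phi>(2) \<psi>(2) by (simp add: puiseux_root_def power_0_left)
  then show ?case by blast
qed

section \<open>The conjugates of a Puiseux root\<close>

lemma filterlim_mult_unity_root:
  "filterlim (\<lambda>t. unity_root d ^ j * t) (nhds 0) (nhds 0)"
  "filterlim (\<lambda>t. unity_root d ^ j * t) (at 0) (at 0)"
proof -
  show *: "filterlim (\<lambda>t. unity_root d ^ j * t) (nhds 0) (nhds 0)"
    using analytic_at_imp_filterlim[of "\<lambda>t. unity_root d ^ j * t" 0] by (simp add: analytic_intros)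
  have "filterlim (\<lambda>t. unity_root d ^ j * t) (nhds 0) (at 0)"
    by (rule filterlim_mono[OF * order_refl at_within_le_nhds])
  then show "filterlim (\<lambda>t. unity_root d ^ j * t) (at 0) (at 0)"
    by (auto simp: filterlim_at eventually_at_filter)
qed

text \<open>The difference \<open>\<phi>(\<zeta>^k t) - \<phi>(t)\<close> has isolated zeros unless it vanishes identically. In the
  latter case \<open>\<phi>\<close> is invariant under the group generated by \<open>\<zeta>^k\<close>, which by Bezout contains
  \<open>\<zeta>^e\<close> for \<open>e = gcd k N\<close>. So \<open>\<phi>\<close> descends to a function of \<open>t^d\<close> with \<open>d = N / e\<close>, and \<open>f\<close> has
  a root with the smaller exponent \<open>e\<close>.\<close>

lemma puiseux_root_minimal_imp_conjugates_differ:
  assumes \<phi>: "puiseux_root f N \<phi>" and min: "\<And>N' \<phi>'. N' < N \<Longrightarrow> \<not> puiseux_root f N' \<phi>'"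
    and k: "0 < k" "k < N"
  shows "\<forall>\<^sub>F t in at 0. \<phi> (unity_root N ^ k * t) \<noteq> \<phi> t"
proof -
  define \<omega> where "\<omega> = unity_root N ^ k"
  have \<phi>_an: "\<phi> analytic_on {0}" and \<phi>0: "\<phi> 0 = 0" and root: "\<forall>\<^sub>F t in nhds 0. f (t ^ N, \<phi> t) = 0"
    using \<phi> by (auto simp: puiseux_root_def)
  have "(\<phi> \<circ> (\<lambda>t. \<omega> * t)) analytic_on {0}"
    by (rule analytic_on_compose) (use \<phi>_an in \<open>auto intro!: analytic_intros\<close>)
  then have "(\<lambda>t. \<phi> (\<omega> * t) - \<phi> t) analytic_on {0}"
    using \<phi>_an by (auto simp: o_def intro!: analytic_intros)
  then show ?thesis
  proof (cases rule: analytic_at_zero_cases)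
    case (2 v w)
    have "\<forall>\<^sub>F t in at 0. w t \<noteq> 0"
      using analytic_at_neq_imp_eventually_neq[OF 2(1,2)] .
    moreover have "\<forall>\<^sub>F t in at 0. \<phi> (\<omega> * t) - \<phi> t = t ^ v * w t"
      using 2(3) by (simp add: eventually_nhds_conv_at)
    moreover have "\<forall>\<^sub>F t :: complex in at 0. t \<noteq> 0"
      by (rule eventually_neq_at_within)
    ultimately show ?thesis
      by eventually_elim (auto simp: \<omega>_def)
  next
    case 1
    define e d where "e = gcd k N" and "d = N div e"
    have "e \<le> k" using k(1) by (auto simp: e_def intro: dvd_imp_le)
    then have "e < N" using k(2) by linarith
    then have e: "e > 0" "e < N" "N = d * e"
      using k(1) by (simp_all add: e_def d_def)
    then have d: "d > 0" by (cases d) auto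
    obtain x y where bez: "k * x = N * y + e"
      using bezout_nat[of k N] k by (auto simp: e_def)
    have inv: "\<forall>\<^sub>F t in nhds 0. \<phi> (\<omega> ^ j * t) = \<phi> t" for j
    proof (induction j)
      case (Suc j)
      have "filterlim (\<lambda>t. \<omega> ^ j * t) (nhds 0) (nhds 0)"
        using filterlim_mult_unity_root(1)[of N "k * j"] by (simp add: \<omega>_def power_mult)
      from eventually_compose_filterlim[OF 1 this] Suc show ?case
        by eventually_elim (simp add: mult.assoc)
    qed simp
    have "\<omega> ^ x = unity_root N ^ (N * y + e)"
      by (simp add: \<omega>_def bez flip: power_mult)
    also have "\<dots> = (unity_root N ^ N) ^ y * unity_root N ^ e"
      by (simp only: power_add power_mult)
    also have "\<dots> = unity_root d"
      using unity_root_power_self[of N] unity_root_power_mult[OF d e(1)] k by (simp flip: e(3))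
    finally have "\<forall>\<^sub>F t in nhds 0. \<phi> (unity_root d * t) = \<phi> t"
      using inv[of x] by simp
    from eventually_nhds_0_fst[OF this]
    have "\<forall>\<^sub>F p in nhds (0 :: complex \<times> complex). \<phi> (unity_root d * fst p) = \<phi> (fst p)" .
    moreover have "holomorphic_near0 (\<lambda>p. \<phi> (fst p))"
      by (rule holomorphic_near0_compose1[of \<phi> fst]) (use \<phi>_an holomorphic_near0_fst in auto)
    ultimately obtain F where F: "holomorphic_near0 F"
      and F_eq: "\<forall>\<^sub>F p in nhds 0. \<phi> (fst p) = F (fst p ^ d, snd p)"
      using holomorphic_near0_descend[OF d, of "\<lambda>p. \<phi> (fst p)"] by auto
    define \<eta> where "\<eta> s = F (s, 0)" for s
    have \<eta>_eq: "\<forall>\<^sub>F t in nhds 0. \<phi> t = \<eta> (t ^ d)"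
      using eventually_nhds_0_slices[OF F_eq] unfolding \<eta>_def
      by eventually_elim (auto dest: eventually_nhds_x_imp_x)
    have "\<forall>\<^sub>F t in nhds 0. f ((t ^ d) ^ e, \<eta> (t ^ d)) = 0"
      using root \<eta>_eq by eventually_elim (simp add: e(3) power_mult)
    then have "\<forall>\<^sub>F s in nhds 0. f (s ^ e, \<eta> s) = 0"
      by (rule eventually_nhds_0_power1[OF d])
    moreover have "\<eta> analytic_on {0}"
      unfolding \<eta>_def by (rule holomorphic_near0_slices(2)[OF F])
    moreover have "\<eta> 0 = 0"
      using eventually_nhds_x_imp_x[OF \<eta>_eq] \<phi>0 d by (simp add: power_0_left)
    ultimately have "puiseux_root f e \<eta>"
      using e by (simp add: puiseux_root_def)
    then show ?thesis using min e by blast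
  qed
qed

text \<open>The linear factors are split off one at a time. After \<open>m\<close> steps the cofactor \<open>g\<close> vanishes along
  \<open>y = \<phi>(\<zeta>^m x)\<close>: at \<open>x \<noteq> 0\<close> because \<open>f(x^N, y)\<close> does and the earlier factors do not, and at \<open>x = 0\<close>
  by continuity. A shear of \<open>y\<close> reduces the next step to division by \<open>y\<close>.\<close>

lemma conjugate_product_divides:
  assumes f: "holomorphic_near0 f" and \<phi>: "puiseux_root f N \<phi>"
    and differ: "\<And>k. 0 < k \<Longrightarrow> k < N \<Longrightarrow> \<forall>\<^sub>F t in at 0. \<phi> (unity_root N ^ k * t) \<noteq> \<phi> t"
    and "m \<le> N"
  shows "\<exists>g. holomorphic_near0 g \<and> (\<forall>\<^sub>F p in nhds 0.
    f (fst p ^ N, snd p) = (\<Prod>k<m. snd p - \<phi> (unity_root N ^ k * fst p)) * g p)"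
  using \<open>m \<le> N\<close>
proof (induction m)
  case 0
  have "holomorphic_near0 (\<lambda>p. f (fst p ^ N, snd p))"
    using \<phi> by (intro holomorphic_near0_compose[of f "\<lambda>p. fst p ^ N" snd] holomorphic_near0_intros f)
      (auto simp: puiseux_root_def power_0_left)
  then show ?case by (intro exI[of _ "\<lambda>p. f (fst p ^ N, snd p)"]) simp
next
  case (Suc m)
  have \<phi>_an: "\<phi> analytic_on {0}" and \<phi>0: "\<phi> 0 = 0" and root: "\<forall>\<^sub>F t in nhds 0. f (t ^ N, \<phi> t) = 0"
    and N: "N > 0"
    using \<phi> by (auto simp: puiseux_root_def)
  obtain g where g: "holomorphic_near0 g" and eq: "\<forall>\<^sub>F p in nhds 0.
      f (fst p ^ N, snd p) = (\<Prod>k<m. snd p - \<phi> (unity_root N ^ k * fst p)) * g p"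
    using Suc by auto
  define c where "c x = \<phi> (unity_root N ^ m * x)" for x
  have "(\<phi> \<circ> (\<lambda>t. unity_root N ^ m * t)) analytic_on {0}"
    by (rule analytic_on_compose) (use \<phi>_an in \<open>auto intro!: analytic_intros\<close>)
  then have c: "c analytic_on {0}" "c 0 = 0"
    using \<phi>0 by (auto simp: c_def[abs_def] o_def)
  have id_an: "(\<lambda>x :: complex. x) analytic_on {0}" by (intro analytic_intros)
  have g_an: "(\<lambda>x. g (x, c x)) analytic_on {0}"
    by (rule holomorphic_near0_curve[OF g id_an c(1) _ c(2)]) simp
  have "filterlim (\<lambda>x. (x, c x)) (nhds 0) (nhds 0)"
    by (rule filterlim_curve[OF id_an c(1) _ c(2)]) simp
  from eventually_compose_filterlim[OF eq this]
  have "\<forall>\<^sub>F x in at 0. f (x ^ N, c x) = (\<Prod>k<m. c x - \<phi> (unity_root N ^ k * x)) * g (x, c x)"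
    by (simp add: eventually_nhds_conv_at)
  moreover have "\<forall>\<^sub>F x in at 0. f (x ^ N, c x) = 0"
  proof -
    have "(unity_root N ^ m) ^ N = 1"
      using unity_root_power_self[OF N] by (metis mult.commute power_mult power_one)
    then show ?thesis
      using eventually_compose_filterlim[OF root filterlim_mult_unity_root(1)[of N m]]
      by (simp add: c_def power_mult_distrib eventually_nhds_conv_at)
  qed
  moreover have "\<forall>\<^sub>F x in at 0. \<forall>k\<in>{..<m}. c x \<noteq> \<phi> (unity_root N ^ k * x)"
  proof (intro eventually_ball_finite ballI)
    fix k assume "k \<in> {..<m}"
    then have k: "0 < m - k" "m - k < N" "k < m" using Suc.prems by auto
    have rot: "unity_root N ^ (m - k) * (unity_root N ^ k * x) = unity_root N ^ m * x" for x
      using k(3) by (simp flip: mult.assoc power_add)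
    then show "\<forall>\<^sub>F x in at 0. c x \<noteq> \<phi> (unity_root N ^ k * x)"
      using eventually_compose_filterlim[OF differ[OF k(1,2)] filterlim_mult_unity_root(2)[of N k]]
      by (simp add: c_def rot)
  qed auto
  ultimately have "\<forall>\<^sub>F x in at 0. g (x, c x) = 0"
    by eventually_elim auto
  moreover from this have "((\<lambda>x. g (x, c x)) \<longlongrightarrow> 0) (at 0)"
    by (rule tendsto_eventually)
  then have "g (0, c 0) = 0"
    using analytic_at_imp_isCont[OF g_an] unfolding isCont_def
    by (metis LIM_unique)
  ultimately have zero: "\<forall>\<^sub>F x in nhds 0. g (x, c x) = 0"
    by (simp add: eventually_nhds_conv_at)
  have c_fst: "holomorphic_near0 (\<lambda>p. c (fst p))"
    by (rule holomorphic_near0_compose1[of c fst]) (use c(1) holomorphic_near0_fst in auto)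
  have "holomorphic_near0 (\<lambda>p. g (fst p, snd p + c (fst p)))"
    by (rule holomorphic_near0_compose[of g fst "\<lambda>p. snd p + c (fst p)"])
      (use c in \<open>auto intro!: holomorphic_near0_intros g c_fst\<close>)
  moreover have "\<forall>\<^sub>F x in nhds 0. g (fst (x, 0 :: complex), snd (x, 0) + c (fst (x, 0 :: complex))) = 0"
    using zero by simp
  ultimately obtain g' where g': "holomorphic_near0 g'"
    and g'_eq: "\<forall>\<^sub>F p in nhds 0. g (fst p, snd p + c (fst p)) = snd p * g' p"
    using holomorphic_near0_divide_snd by blast
  have lin: "holomorphic_near0 (\<lambda>p. snd p - c (fst p))"
    by (intro holomorphic_near0_intros c_fst)
  define h where "h p = g' (fst p, snd p - c (fst p))" for p
  have h: "holomorphic_near0 h"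
    unfolding h_def
    by (rule holomorphic_near0_compose[of g' fst]) (use c lin g' holomorphic_near0_fst in auto)
  have "filterlim (\<lambda>p. (fst p, snd p - c (fst p))) (nhds 0) (nhds 0)"
    using holomorphic_near0_imp_filterlim[OF holomorphic_near0_fst] holomorphic_near0_imp_filterlim[OF lin] c(2)
    by (intro filterlim_Pair_nhds_0) auto
  from eventually_compose_filterlim[OF g'_eq this] eq
  have "\<forall>\<^sub>F p in nhds 0. f (fst p ^ N, snd p) = (\<Prod>k<Suc m. snd p - \<phi> (unity_root N ^ k * fst p)) * h p"
    by eventually_elim (simp add: h_def c_def mult.assoc)
  then show ?case using h by blast
qed

text \<open>The product of the conjugate factors is invariant under \<open>x \<mapsto> \<zeta> x\<close>, which permutes them. Its
  cofactor inherits the invariance wherever the product does not vanish, hence everywhere by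
  continuity. Both then descend along \<open>x \<mapsto> x^N\<close>.\<close>

lemma puiseux_root_factor:
  assumes f: "holomorphic_near0 f" and \<phi>: "puiseux_root f N \<phi>"
    and differ: "\<And>k. 0 < k \<Longrightarrow> k < N \<Longrightarrow> \<forall>\<^sub>F t in at 0. \<phi> (unity_root N ^ k * t) \<noteq> \<phi> t"
  shows "\<exists>F G. holomorphic_near0 F \<and> holomorphic_near0 G \<and> (\<forall>\<^sub>F p in nhds 0. f p = F p * G p) \<and>
    (\<forall>\<^sub>F p in nhds 0. F (fst p ^ N, snd p) = (\<Prod>k<N. snd p - \<phi> (unity_root N ^ k * fst p)))"
proof -
  have \<phi>_an: "\<phi> analytic_on {0}" and N: "N > 0"
    using \<phi> by (auto simp: puiseux_root_def)
  let ?\<zeta> = "unity_root N"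
  define P where "P p = (\<Prod>k<N. snd p - \<phi> (?\<zeta> ^ k * fst p))" for p
  have P_inv: "P (?\<zeta> * x, y) = P (x, y)" for x y
  proof -
    obtain M where M: "N = Suc M" using N by (cases N) auto
    define h where "h k = y - \<phi> (?\<zeta> ^ k * x)" for k
    have "h N = h 0" using unity_root_power_self[OF N] by (simp add: h_def)
    have "P (?\<zeta> * x, y) = (\<Prod>k<N. h (Suc k))"
      by (simp add: P_def h_def mult_ac)
    also have "\<dots> = h 0 * (\<Prod>k<M. h (Suc k))"
      using \<open>h N = h 0\<close> by (simp add: M mult.commute)
    also have "\<dots> = (\<Prod>k<N. h k)"
      unfolding M by (rule prod.lessThan_Suc_shift[symmetric])
    finally show ?thesis by (simp add: P_def h_def)
  qed
  have "holomorphic_near0 (\<lambda>p. \<phi> (?\<zeta> ^ k * fst p))" for k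
    by (rule holomorphic_near0_compose1[of \<phi>])
      (use \<phi>_an in \<open>auto intro!: holomorphic_near0_intros\<close>)
  then have P: "holomorphic_near0 P"
    unfolding P_def[abs_def] by (intro holomorphic_near0_intros) auto
  obtain g where g: "holomorphic_near0 g" and eq: "\<forall>\<^sub>F p in nhds 0. f (fst p ^ N, snd p) = P p * g p"
    using conjugate_product_divides[OF f \<phi> differ, of N] by (auto simp: P_def)
  have "\<forall>\<^sub>F p in nhds 0. complex_differentiable2 g p \<and> f (fst p ^ N, snd p) = P p * g p"
    using g eq unfolding holomorphic_near0_iff by eventually_elim simp
  then obtain r where r: "r > 0" and
    "\<forall>x\<in>ball 0 r. \<forall>y\<in>ball 0 r. complex_differentiable2 g (x, y) \<and> f (x ^ N, y) = P (x, y) * g (x, y)"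
    unfolding eventually_nhds_0_polydisc by auto
  then have g_hol: "\<forall>p\<in>ball 0 r \<times> ball 0 r. complex_differentiable2 g p"
    and g_eq: "\<And>x y. x \<in> ball 0 r \<Longrightarrow> y \<in> ball 0 r \<Longrightarrow> f (x ^ N, y) = P (x, y) * g (x, y)"
    by auto
  have g_inv: "g (?\<zeta> * x, y) = g (x, y)" if x: "x \<in> ball 0 r" and y: "y \<in> ball 0 r" for x y
  proof -
    have \<zeta>x: "?\<zeta> * x \<in> ball 0 r" using x by (simp add: norm_mult)
    have cont: "isCont (\<lambda>w. g (x', w)) y" if "x' \<in> ball 0 r" for x'
      using complex_differentiable2_slices(2)[OF g_hol that] y
      by (metis continuous_on_eq_continuous_at holomorphic_on_imp_continuous_on open_ball)
    have "\<forall>\<^sub>F w in at y. \<forall>k\<in>{..<N}. w \<noteq> \<phi> (?\<zeta> ^ k * x)"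
      by (intro eventually_ball_finite ballI eventually_neq_at_within) auto
    moreover have "\<forall>\<^sub>F w in at y. w \<in> ball 0 r"
      using y by (intro eventually_at_in_open') auto
    ultimately have "\<forall>\<^sub>F w in at y. g (?\<zeta> * x, w) = g (x, w)"
    proof eventually_elim
      case (elim w)
      have "P (x, w) \<noteq> 0" using elim(1) by (simp add: P_def)
      moreover have "P (x, w) * g (?\<zeta> * x, w) = P (x, w) * g (x, w)"
        using g_eq[OF x elim(2)] g_eq[OF \<zeta>x elim(2)] P_inv[of x w] unity_root_power_self[OF N]
        by (auto simp: power_mult_distrib)
      ultimately show ?case by simp
    qed
    then have "((\<lambda>w. g (?\<zeta> * x, w)) \<longlongrightarrow> g (x, y)) (at y)"
      using tendsto_cong[of "\<lambda>w. g (?\<zeta> * x, w)" "\<lambda>w. g (x, w)"] cont[OF x] by (simp add: isCont_def)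
    then show ?thesis
      using cont[OF \<zeta>x] unfolding isCont_def by (metis LIM_unique)
  qed
  have "\<forall>\<^sub>F p in nhds 0. g (?\<zeta> * fst p, snd p) = g p"
    unfolding eventually_nhds_0_polydisc using r g_inv by (intro exI[of _ r]) auto
  then obtain G where G: "holomorphic_near0 G" "\<forall>\<^sub>F p in nhds 0. g p = G (fst p ^ N, snd p)"
    using holomorphic_near0_descend[OF N g] by blast
  obtain F where F: "holomorphic_near0 F" "\<forall>\<^sub>F p in nhds 0. P p = F (fst p ^ N, snd p)"
    using holomorphic_near0_descend[OF N P] P_inv by auto
  have "\<forall>\<^sub>F p in nhds 0. f (fst p ^ N, snd p) = F (fst p ^ N, snd p) * G (fst p ^ N, snd p)"
    using eq F(2) G(2) by eventually_elim simp
  then have "\<forall>\<^sub>F p in nhds 0. f p = F p * G p"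
    using eventually_nhds_0_power[OF N, of "\<lambda>p. f p = F p * G p"] by simp
  moreover have "\<forall>\<^sub>F p in nhds 0. F (fst p ^ N, snd p) = (\<Prod>k<N. snd p - \<phi> (?\<zeta> ^ k * fst p))"
    using F(2) by eventually_elim (simp add: P_def)
  ultimately show ?thesis using F(1) G(1) by blast
qed

section \<open>The image of a branch parametrization\<close>

lemma holo_germ_cases:
  obtains f0 where "holomorphic_near0 f0" "f = abs_holo_germ f0"
proof -
  have "holo_germ_rel (rep_holo_germ f) (rep_holo_germ f)"
    by (rule Quotient_rep_reflp[OF Quotient_holo_germ])
  moreover have "f = abs_holo_germ (rep_holo_germ f)"
    by (rule Quotient_abs_rep[OF Quotient_holo_germ, symmetric])
  ultimately show thesis using that by (auto simp: holo_germ_rel_def)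
qed

lemma holo_germ_rel_self: "holomorphic_near0 f \<Longrightarrow> holo_germ_rel f f"
  by (simp add: holo_germ_rel_def)

lemma abs_holo_germ_eq:
  "holomorphic_near0 f \<Longrightarrow> holomorphic_near0 g \<Longrightarrow> \<forall>\<^sub>F p in nhds 0. f p = g p \<Longrightarrow>
     abs_holo_germ f = abs_holo_germ g"
  using Quotient_rel_abs[OF Quotient_holo_germ] by (simp add: holo_germ_rel_def)

lemma germ_value0_unit:
  assumes "f dvd 1"
  shows "germ_value0 f \<noteq> 0"
proof -
  obtain g where "1 = f * g" using assms by (elim dvdE)
  moreover have "germ_value0 (f * g) = germ_value0 f * germ_value0 g" by transfer simp
  moreover have "germ_value0 1 = 1" by transfer simp
  ultimately show ?thesis by auto
qed

text \<open>\<open>F\<close> vanishes at the origin, so it is not a unit; by irreducibility the other factor is one,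
  and it has no zeros near the origin.\<close>

lemma irreducible_germ_zero_set:
  assumes "irreducible (abs_holo_germ f)" and f: "holomorphic_near0 f"
    and F: "holomorphic_near0 F" "F 0 = 0" and G: "holomorphic_near0 G"
    and eq: "\<forall>\<^sub>F p in nhds 0. f p = F p * G p"
  shows "\<forall>\<^sub>F p in nhds 0. f p = 0 \<longleftrightarrow> F p = 0"
proof -
  have val: "germ_value0 (abs_holo_germ h) = h 0" if "holomorphic_near0 h" for h
    by (rule germ_value0.abs_eq[OF holo_germ_rel_self[OF that]])
  have "abs_holo_germ f = abs_holo_germ F * abs_holo_germ G"
    using abs_holo_germ_eq[OF f holomorphic_near0_mult[OF F(1) G] eq]
    by (simp add: times_holo_germ.abs_eq holo_germ_rel_self F(1) G)
  then have "abs_holo_germ F dvd 1 \<or> abs_holo_germ G dvd 1"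
    by (rule irreducibleD[OF assms(1)])
  then have "G 0 \<noteq> 0"
    using germ_value0_unit val[OF F(1)] val[OF G] F(2) by fastforce
  then have "\<forall>\<^sub>F p in nhds 0. G p \<noteq> 0"
    using tendsto_imp_eventually_ne[OF holomorphic_near0_imp_filterlim[OF G]] by blast
  with eq show ?thesis by eventually_elim simp
qed

text \<open>The image germ must not depend on the neighbourhood of 0 in the parameter line. For this the
  images of arbitrarily small discs have to cover all zeros close enough to the origin.\<close>

lemma parametrization_of_zero_set:
  assumes f: "holomorphic_near0 f" and curve: "is_curve (zero_set_germ (abs_holo_germ f))"
    and r: "r > 0" and hol: "u holomorphic_on ball 0 r" "v holomorphic_on ball 0 r"
    and uv0: "u 0 = 0" "v 0 = 0"
    and inj: "inj_on (\<lambda>t. (u t, v t)) (ball 0 r)"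
    and root: "\<And>t. t \<in> ball 0 r \<Longrightarrow> f (u t, v t) = 0"
    and onto: "\<And>e. e > 0 \<Longrightarrow> \<forall>\<^sub>F p in nhds 0. f p = 0 \<longrightarrow> p \<in> (\<lambda>t. (u t, v t)) ` ball 0 e"
  shows "\<exists>\<alpha>. parametric_equation \<alpha> (zero_set_germ (abs_holo_germ f)) \<and>
    has_image_germ \<alpha> (zero_set_germ (abs_holo_germ f))"
proof -
  define \<alpha> where "\<alpha> t = (u t, v t)" for t
  have Z: "zero_set_germ (abs_holo_germ f) = set_germ (f -` {0})"
    by (simp add: zero_set_germ.abs_eq[OF holo_germ_rel_self[OF f]] set_germ.abs_eq)
  have "subgerm (set_germ (\<alpha> ` ball 0 r)) (set_germ (f -` {0}))"
    unfolding set_germ.abs_eq subgerm.abs_eq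
    using root by (intro exI[of _ UNIV]) (auto simp: \<alpha>_def)
  then have "parametric_equation \<alpha> (zero_set_germ (abs_holo_germ f))"
    unfolding parametric_equation_def Z
    using curve hol r uv0 inj unfolding Z
    by (intro conjI exI[of _ "ball 0 r"]) (auto simp: \<alpha>_def[abs_def] zero_prod_def)
  moreover have "has_image_germ \<alpha> (zero_set_germ (abs_holo_germ f))"
    unfolding has_image_germ_def Z
  proof (intro exI[of _ "ball 0 r"] conjI allI impI)
    fix V :: "complex set" assume V: "open V \<and> 0 \<in> V \<and> V \<subseteq> ball 0 r"
    then obtain e where e: "e > 0" "ball 0 e \<subseteq> V"
      using open_contains_ball by blast
    have "\<forall>\<^sub>F p in nhds 0. p \<in> \<alpha> ` V \<longleftrightarrow> p \<in> f -` {0}"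
      using onto[OF e(1)] by eventually_elim (use V e root in \<open>auto simp: \<alpha>_def\<close>)
    then show "set_germ (\<alpha> ` V) = set_germ (f -` {0})"
      by (simp add: set_germ.abs_eq set_germ.abs_eq_iff set_germ_rel_iff)
  qed (use r in auto)
  ultimately show ?thesis by blast
qed

text \<open>Two parameters with equal \<open>N\<close>-th powers differ by a factor \<open>\<zeta>^j\<close>, so injectivity amounts to
  the conjugates being distinct. A zero \<open>(s^N, y)\<close> satisfies \<open>y = \<phi>(\<zeta>^k s)\<close> for some \<open>k\<close>, and is the
  point with parameter \<open>\<zeta>^k s\<close>, which has the same modulus as \<open>s\<close>; so small discs suffice.\<close>

lemma puiseux_root_parametrization:
  assumes f: "holomorphic_near0 f" and curve: "is_curve (zero_set_germ (abs_holo_germ f))"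
    and \<phi>: "puiseux_root f N \<phi>"
    and differ: "\<And>k. 0 < k \<Longrightarrow> k < N \<Longrightarrow> \<forall>\<^sub>F t in at 0. \<phi> (unity_root N ^ k * t) \<noteq> \<phi> t"
    and zeros: "\<forall>\<^sub>F p in nhds 0. f (fst p ^ N, snd p) = 0 \<longleftrightarrow>
      (\<Prod>k<N. snd p - \<phi> (unity_root N ^ k * fst p)) = 0"
  shows "\<exists>\<alpha>. parametric_equation \<alpha> (zero_set_germ (abs_holo_germ f)) \<and>
    has_image_germ \<alpha> (zero_set_germ (abs_holo_germ f))"
proof -
  have N: "N > 0" and \<phi>_an: "\<phi> analytic_on {0}" and \<phi>0: "\<phi> 0 = 0"
    and root: "\<forall>\<^sub>F t in nhds 0. f (t ^ N, \<phi> t) = 0"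
    using \<phi> by (auto simp: puiseux_root_def)
  have "\<forall>\<^sub>F t in at 0. \<forall>k\<in>{0<..<N}. \<phi> (unity_root N ^ k * t) \<noteq> \<phi> t"
    by (intro eventually_ball_finite ballI differ) auto
  then have "\<forall>\<^sub>F t in nhds 0. t \<noteq> 0 \<longrightarrow> (\<forall>k\<in>{0<..<N}. \<phi> (unity_root N ^ k * t) \<noteq> \<phi> t)"
    by (simp add: eventually_at_filter)
  with root have "\<forall>\<^sub>F t in nhds 0. f (t ^ N, \<phi> t) = 0 \<and>
      (t \<noteq> 0 \<longrightarrow> (\<forall>k\<in>{0<..<N}. \<phi> (unity_root N ^ k * t) \<noteq> \<phi> t))"
    by eventually_elim simp
  then obtain r1 where r1: "r1 > 0" "\<And>t. dist t 0 < r1 \<Longrightarrow> f (t ^ N, \<phi> t) = 0 \<and>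
      (t \<noteq> 0 \<longrightarrow> (\<forall>k\<in>{0<..<N}. \<phi> (unity_root N ^ k * t) \<noteq> \<phi> t))"
    unfolding eventually_nhds_metric by blast
  obtain r2 where r2: "r2 > 0" "\<phi> holomorphic_on ball 0 r2"
    using \<phi>_an unfolding analytic_on_def by auto
  define r where "r = min r1 r2"
  have r: "r > 0" "\<phi> holomorphic_on ball 0 r"
    using r1 r2 by (auto simp: r_def intro: holomorphic_on_subset)
  have root_r: "f (t ^ N, \<phi> t) = 0"
    and differ_r: "t \<noteq> 0 \<Longrightarrow> 0 < k \<Longrightarrow> k < N \<Longrightarrow> \<phi> (unity_root N ^ k * t) \<noteq> \<phi> t"
    if "t \<in> ball 0 r" for t k
    using r1(2)[of t] that by (auto simp: r_def)
  show ?thesis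
  proof (rule parametrization_of_zero_set[OF f curve r(1) _ r(2)])
    show "(\<lambda>t. t ^ N) holomorphic_on ball 0 r" by (intro holomorphic_intros)
    show "0 ^ N = (0 :: complex)" using N by simp
    show "\<phi> 0 = 0" by (rule \<phi>0)
    show "inj_on (\<lambda>t. (t ^ N, \<phi> t)) (ball 0 r)"
    proof (rule inj_onI)
      fix s t assume st: "s \<in> ball 0 r" "t \<in> ball 0 r" "(s ^ N, \<phi> s) = (t ^ N, \<phi> t)"
      then obtain j where j: "j < N" "s = unity_root N ^ j * t"
        using same_power_imp_unity_root_mult[OF N, of s t] by auto
      show "s = t"
        using differ_r[OF st(2), of j] j st(3) by (cases "t = 0"; cases "j = 0") auto
    qed
    show "f (t ^ N, \<phi> t) = 0" if "t \<in> ball 0 r" for t by (rule root_r[OF that])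
    fix e :: real assume e: "e > 0"
    have "\<forall>\<^sub>F p in nhds (0 :: complex \<times> complex). fst p \<in> ball 0 e"
      using e by (intro eventually_nhds_0_fst[where Q = "\<lambda>x. x \<in> ball 0 e"] eventually_nhds_in_open) auto
    with zeros have "\<forall>\<^sub>F p in nhds 0. f (fst p ^ N, snd p) = 0 \<longrightarrow>
        (fst p ^ N, snd p) \<in> (\<lambda>t. (t ^ N, \<phi> t)) ` ball 0 e"
    proof eventually_elim
      case (elim p)
      show ?case
      proof
        assume "f (fst p ^ N, snd p) = 0"
        then obtain k where k: "snd p = \<phi> (unity_root N ^ k * fst p)"
          using elim(1) by auto
        have "(unity_root N ^ k) ^ N = 1"
          using unity_root_power_self[OF N] by (metis mult.commute power_mult power_one)
        then have "(fst p ^ N, snd p) = ((unity_root N ^ k * fst p) ^ N, \<phi> (unity_root N ^ k * fst p))"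
          by (simp add: k power_mult_distrib)
        moreover have "unity_root N ^ k * fst p \<in> ball 0 e"
          using elim(2) by (simp add: norm_mult norm_power)
        ultimately show "(fst p ^ N, snd p) \<in> (\<lambda>t. (t ^ N, \<phi> t)) ` ball 0 e" by blast
      qed
    qed
    then show "\<forall>\<^sub>F p in nhds 0. f p = 0 \<longrightarrow> p \<in> (\<lambda>t. (t ^ N, \<phi> t)) ` ball 0 e"
      using eventually_nhds_0_power[OF N, of "\<lambda>p. f p = 0 \<longrightarrow> p \<in> (\<lambda>t. (t ^ N, \<phi> t)) ` ball 0 e"]
      by blast
  qed
qed

theorem proposition1p4p8:
  fixes B :: "(complex \<times> complex) set_germ"
  assumes "is_branch B"
  shows "\<exists>\<alpha>. parametric_equation \<alpha> B \<and> has_image_germ \<alpha> B"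
proof -
  obtain germ where germ: "germ \<noteq> 0" "germ_value0 germ = 0" "irreducible germ" "B = zero_set_germ germ"
    using assms unfolding is_branch_def by blast
  then have curve: "is_curve B" unfolding is_curve_def by blast
  obtain f where f: "holomorphic_near0 f" and germ_f: "germ = abs_holo_germ f"
    by (rule holo_germ_cases)
  have B: "B = zero_set_germ (abs_holo_germ f)" using germ germ_f by simp
  note curve = curve[unfolded B]
  note irr = germ(3)[unfolded germ_f]
  have f0: "f 0 = 0"
    using germ(2) germ_value0.abs_eq[OF holo_germ_rel_self[OF f]] by (simp add: germ_f)
  have "(\<lambda>y. f (0, y)) analytic_on {0}"
    by (rule holomorphic_near0_curve[OF f]) (auto intro: analytic_intros)
  then show ?thesis
  proof (cases rule: analytic_at_zero_cases)
    case 1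
    define h where "h p = f (snd p, fst p)" for p
    have "holomorphic_near0 h"
      unfolding h_def[abs_def] by (rule holomorphic_near0_compose[OF f holomorphic_near0_snd holomorphic_near0_fst]) auto
    moreover have "\<forall>\<^sub>F x in nhds 0. h (x, 0) = 0" using 1 by (simp add: h_def)
    ultimately obtain g where g: "holomorphic_near0 g" "\<forall>\<^sub>F p in nhds 0. h p = snd p * g p"
      using holomorphic_near0_divide_snd by blast
    have "filterlim (\<lambda>p. (snd p, fst p)) (nhds 0) (nhds (0 :: complex \<times> complex))"
      using holomorphic_near0_imp_filterlim[OF holomorphic_near0_fst]
        holomorphic_near0_imp_filterlim[OF holomorphic_near0_snd]
      by (intro filterlim_Pair_nhds_0) auto
    from eventually_compose_filterlim[OF g(2) this]
    have eq: "\<forall>\<^sub>F p in nhds 0. f p = fst p * g (snd p, fst p)" by (simp add: h_def)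
    have "holomorphic_near0 (\<lambda>p. g (snd p, fst p))"
      by (rule holomorphic_near0_compose[OF g(1) holomorphic_near0_snd holomorphic_near0_fst]) auto
    then have zeros: "\<forall>\<^sub>F p in nhds 0. f p = 0 \<longleftrightarrow> fst p = 0"
      using irreducible_germ_zero_set[OF irr f holomorphic_near0_fst _ _ eq] by simp
    obtain r where r: "r > 0" "\<And>y. dist y 0 < r \<Longrightarrow> f (0, y) = 0"
      using 1 unfolding eventually_nhds_metric by blast
    show ?thesis
      unfolding B
    proof (rule parametrization_of_zero_set[OF f curve r(1), of "\<lambda>_. 0" "\<lambda>t. t"])
      fix e :: real assume "e > 0"
      then have "\<forall>\<^sub>F p in nhds (0 :: complex \<times> complex). snd p \<in> ball 0 e"
        unfolding eventually_nhds_0_polydisc by auto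
      with zeros show "\<forall>\<^sub>F p in nhds 0. f p = 0 \<longrightarrow> p \<in> (\<lambda>t. (0, t)) ` ball 0 e"
        by eventually_elim (auto simp: image_iff prod_eq_iff)
    qed (use r in \<open>auto simp: inj_on_def intro: holomorphic_intros\<close>)
  next
    case (2 n w)
    have "n \<noteq> 0"
      using eventually_nhds_x_imp_x[OF 2(3)] 2(2) f0 by (auto simp: zero_prod_def)
    moreover have "order_snd f n" using 2 unfolding order_snd_def by blast
    ultimately have "\<exists>N \<phi>. puiseux_root f N \<phi>"
      using puiseux_root_exists[of n f] f by (simp add: Suc_leI)
    define N where "N = (LEAST N. \<exists>\<phi>. puiseux_root f N \<phi>)"
    obtain \<phi> where \<phi>: "puiseux_root f N \<phi>"
      using LeastI_ex[OF \<open>\<exists>N \<phi>. puiseux_root f N \<phi>\<close>] unfolding N_def by blast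
    have differ: "\<forall>\<^sub>F t in at 0. \<phi> (unity_root N ^ k * t) \<noteq> \<phi> t" if "0 < k" "k < N" for k
      by (rule puiseux_root_minimal_imp_conjugates_differ[OF \<phi> _ that])
        (use not_less_Least in \<open>unfold N_def, blast\<close>)
    obtain F G where FG: "holomorphic_near0 F" "holomorphic_near0 G" "\<forall>\<^sub>F p in nhds 0. f p = F p * G p"
      and F: "\<forall>\<^sub>F p in nhds 0. F (fst p ^ N, snd p) = (\<Prod>k<N. snd p - \<phi> (unity_root N ^ k * fst p))"
      using puiseux_root_factor[OF f \<phi> differ] by blast
    have N: "N > 0" and \<phi>0: "\<phi> 0 = 0" using \<phi> by (auto simp: puiseux_root_def)
    have "F 0 = 0"
      using eventually_nhds_x_imp_x[OF F] N \<phi>0 by (simp add: zero_prod_def power_0_left)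
    then have zeros: "\<forall>\<^sub>F p in nhds 0. f p = 0 \<longleftrightarrow> F p = 0"
      by (rule irreducible_germ_zero_set[OF irr f FG(1) _ FG(2,3)])
    have "filterlim (\<lambda>p :: complex \<times> complex. fst p ^ N) (nhds 0) (nhds 0)"
      using holomorphic_near0_imp_filterlim[OF holomorphic_near0_power[OF holomorphic_near0_fst, of N]] N
      by (simp add: power_0_left)
    then have "filterlim (\<lambda>p :: complex \<times> complex. (fst p ^ N, snd p)) (nhds 0) (nhds 0)"
      using holomorphic_near0_imp_filterlim[OF holomorphic_near0_snd]
      by (intro filterlim_Pair_nhds_0) auto
    from eventually_compose_filterlim[OF zeros this] F
    have zeros_pullback: "\<forall>\<^sub>F p in nhds 0. f (fst p ^ N, snd p) = 0 \<longleftrightarrow>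
        (\<Prod>k<N. snd p - \<phi> (unity_root N ^ k * fst p)) = 0"
      by eventually_elim simp
    show ?thesis
      unfolding B
      by (rule puiseux_root_parametrization[OF f curve \<phi> _ zeros_pullback]) (rule differ)
  qed
qed

end
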